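(* Let $G$ be a countably infinite group. Let $L$ be a countable relational language and let $\mathcal{K}$ be a class of countable $L$-structures which is closed under isomorphism. Suppose that $F(G,2)$ is Borel $\mathcal{K}$-structurable. Then every equivalence relation generated by a free Borel action of $G$ (on a standard Borel space) is Borel $\mathcal{K}$-structurable.
   Context: $G$ acts on $2^G=\{0,1\}^G$ (product topology) by $(g\cdot w)(h)=w(g^{-1}h)$, and $\mathrm{Free}(2^G)=\{w\in 2^G : \forall g\in G\ (g\neq 1_G\Rightarrow g\cdot w\neq w)\}$. $F(G,2)$ denotes the orbit equivalence relation on $\mathrm{Free}(2^G)$ generated by the action $G\curvearrowright\mathrm{Free}(2^G)$. Let $L=(R_i)_{i\in I}$ be a countable relational language, where $R_i$ has arity $n_i$, and let $\mathcal{K}$ be a class of countable $L$-structures closed under isomorphism. A countable Borel equivalence relation $E$ on a standard Borel space $X$ is Borel $\mathcal{K}$-structurable if there exists a collection $(Q_i)_{i\in I}$ of Borel sets with $Q_i\subseteq\{(x_0,\dots,x_{n_i-1})\in X^{n_i} : x_0\,E\,x_1\,E\cdots E\,x_{n_i-1}\}$ for each $i\in I$, such that for every $x\in X$ the $L$-structure $\langle [x]_E,(Q_i\restriction [x]_E)_{i\in I}\rangle$ is in $\mathcal{K}$, where $[x]_E$ is the $E$-class of $x$ and $Q_i\restriction[x]_E = Q_i\cap [x]_E^{n_i}$. An action is free if no non-identity group element fixes a point. *)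

theory Defs
  imports "HOL-Analysis.Analysis" "HOL-Algebra.Group_Action"
begin

section \<open>Standard Borel spaces and countable Borel equivalence relations\<close>

text \<open>Measurable spaces are carried by the type of measures; only \<open>space\<close> and \<open>sets\<close> are used,
  the measure itself plays no role.\<close>

definition borel_of :: "'a topology \<Rightarrow> 'a measure"
  where "borel_of T = sigma (topspace T) {U. openin T U}"

text \<open>For metrizable topologies second countability is equivalent to separability.\<close>

definition polish_topology :: "'a topology \<Rightarrow> bool"
  where "polish_topology T \<longleftrightarrow> completely_metrizable_space T \<and> second_countable T"

definition standard_borel_space :: "'a measure \<Rightarrow> bool"
  where "standard_borel_space X \<longleftrightarrow>
    (\<exists>T. polish_topology T \<and> topspace T = space X \<and> sets X = sets (borel_of T))"

definition countable_borel_equiv_rel :: "'a measure \<Rightarrow> ('a \<times> 'a) set \<Rightarrow> bool"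
  where "countable_borel_equiv_rel X E \<longleftrightarrow>
    equiv (space X) E \<and> E \<in> sets (X \<Otimes>\<^sub>M X) \<and> (\<forall>x\<in>space X. countable (E `` {x}))"

section \<open>Relational structures\<close>

record 'i rel_language =
  symbols :: "'i set"
  arity :: "'i \<Rightarrow> nat"

text \<open>An \<open>n\<close>-tuple is an extensional function on \<open>{..<n}\<close>.\<close>

abbreviation tuples :: "nat \<Rightarrow> 'a set \<Rightarrow> (nat \<Rightarrow> 'a) set"
  where "tuples n A \<equiv> {..<n} \<rightarrow>\<^sub>E A"

record ('i, 'a) rel_structure =
  universe :: "'a set"
  interp :: "'i \<Rightarrow> (nat \<Rightarrow> 'a) set"

definition is_structure :: "'i rel_language \<Rightarrow> ('i, 'a) rel_structure \<Rightarrow> bool"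
  where "is_structure L M \<longleftrightarrow>
    (\<forall>i\<in>symbols L. interp M i \<subseteq> tuples (arity L i) (universe M))"

definition isomorphic_structures ::
    "'i rel_language \<Rightarrow> ('i, 'a) rel_structure \<Rightarrow> ('i, 'b) rel_structure \<Rightarrow> bool"
  where "isomorphic_structures L M N \<longleftrightarrow>
    (\<exists>f. bij_betw f (universe M) (universe N) \<and>
      (\<forall>i\<in>symbols L. \<forall>t\<in>tuples (arity L i) (universe M).
        t \<in> interp M i \<longleftrightarrow> compose {..<arity L i} f t \<in> interp N i))"

text \<open>Every countable structure has an isomorphic copy whose universe is a set of natural numbers.
  An isomorphism-closed class of countable structures, which ranges over universes of all types, is
  therefore given by its members with universe in \<open>nat\<close>, and a structure over another type belongs
  to the class iff it is isomorphic to one of these.\<close>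

definition iso_closed_class :: "'i rel_language \<Rightarrow> ('i, nat) rel_structure set \<Rightarrow> bool"
  where "iso_closed_class L K \<longleftrightarrow>
    (\<forall>M\<in>K. is_structure L M) \<and>
    (\<forall>M\<in>K. \<forall>N. is_structure L N \<and> isomorphic_structures L M N \<longrightarrow> N \<in> K)"

definition in_class ::
    "'i rel_language \<Rightarrow> ('i, nat) rel_structure set \<Rightarrow> ('i, 'a) rel_structure \<Rightarrow> bool"
  where "in_class L K M \<longleftrightarrow> is_structure L M \<and> (\<exists>N\<in>K. isomorphic_structures L M N)"

section \<open>Borel structurability\<close>

definition borel_structurable ::
    "'i rel_language \<Rightarrow> ('i, nat) rel_structure set \<Rightarrow> 'a measure \<Rightarrow> ('a \<times> 'a) set \<Rightarrow> bool"
  where "borel_structurable L K X E \<longleftrightarrow>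
    standard_borel_space X \<and> countable_borel_equiv_rel X E \<and>
    (\<exists>Q. (\<forall>i\<in>symbols L. Q i \<in> sets (PiM {..<arity L i} (\<lambda>_. X)) \<and>
            Q i \<subseteq> {t \<in> tuples (arity L i) (space X).
                      \<forall>j. Suc j < arity L i \<longrightarrow> (t j, t (Suc j)) \<in> E}) \<and>
         (\<forall>x\<in>space X.
            in_class L K \<lparr>universe = E `` {x},
                          interp = (\<lambda>i. Q i \<inter> tuples (arity L i) (E `` {x}))\<rparr>))"

section \<open>Borel actions and the Bernoulli shift\<close>

definition orbit_equiv_rel ::
    "('g, 'm) monoid_scheme \<Rightarrow> 'a set \<Rightarrow> ('g \<Rightarrow> 'a \<Rightarrow> 'a) \<Rightarrow> ('a \<times> 'a) set"
  where "orbit_equiv_rel G A \<phi> = {(x, y). x \<in> A \<and> y \<in> orbit G \<phi> x}"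

definition borel_action ::
    "('g, 'm) monoid_scheme \<Rightarrow> 'a measure \<Rightarrow> ('g \<Rightarrow> 'a \<Rightarrow> 'a) \<Rightarrow> bool"
  where "borel_action G X \<phi> \<longleftrightarrow>
    group_action G (space X) \<phi> \<and>
    (\<lambda>(g, x). \<phi> g x) \<in> count_space (carrier G) \<Otimes>\<^sub>M X \<rightarrow>\<^sub>M X"

definition free_action ::
    "('g, 'm) monoid_scheme \<Rightarrow> 'a set \<Rightarrow> ('g \<Rightarrow> 'a \<Rightarrow> 'a) \<Rightarrow> bool"
  where "free_action G A \<phi> \<longleftrightarrow>
    (\<forall>g\<in>carrier G. g \<noteq> \<one>\<^bsub>G\<^esub> \<longrightarrow> (\<forall>x\<in>A. \<phi> g x \<noteq> x))"

text \<open>Elements of \<open>2\<^sup>G\<close> are extensional functions from \<open>carrier G\<close> to \<open>bool\<close>.\<close>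

definition shift_topology :: "('g, 'm) monoid_scheme \<Rightarrow> ('g \<Rightarrow> bool) topology"
  where "shift_topology G = product_topology (\<lambda>_. discrete_topology UNIV) (carrier G)"

definition shift :: "('g, 'm) monoid_scheme \<Rightarrow> 'g \<Rightarrow> ('g \<Rightarrow> bool) \<Rightarrow> 'g \<Rightarrow> bool"
  where "shift G g w = (\<lambda>h\<in>carrier G. w (inv\<^bsub>G\<^esub> g \<otimes>\<^bsub>G\<^esub> h))"

definition free_part :: "('g, 'm) monoid_scheme \<Rightarrow> ('g \<Rightarrow> bool) set"
  where "free_part G =
    {w \<in> carrier G \<rightarrow>\<^sub>E UNIV. \<forall>g\<in>carrier G. g \<noteq> \<one>\<^bsub>G\<^esub> \<longrightarrow> shift G g w \<noteq> w}"

definition free_part_borel :: "('g, 'm) monoid_scheme \<Rightarrow> ('g \<Rightarrow> bool) measure"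
  where "free_part_borel G = borel_of (subtopology (shift_topology G) (free_part G))"

definition F2 :: "('g, 'm) monoid_scheme \<Rightarrow> (('g \<Rightarrow> bool) \<times> ('g \<Rightarrow> bool)) set"
  where "F2 G = orbit_equiv_rel G (free_part G) (shift G)"

subsection \<open>The presuppositions of structurability hold for \<open>F(G,2)\<close>\<close>

text \<open>The first two conjuncts of \<open>borel_structurable\<close> are automatic for \<open>F(G,2)\<close>, so a
  hypothesis that \<open>F(G,2)\<close> is Borel structurable does not assume more than the existence
  of the family \<open>Q\<close>.\<close>

lemma topspace_shift: "topspace (shift_topology G) = carrier G \<rightarrow>\<^sub>E UNIV"
  by (simp add: shift_topology_def)

lemma free_part_subset: "free_part G \<subseteq> topspace (shift_topology G)"
  by (auto simp: free_part_def topspace_shift)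

lemma space_free_part: "space (free_part_borel G) = free_part G"
  using free_part_subset[of G] by (auto simp: free_part_borel_def borel_of_def space_measure_of_conv)

lemma sets_borel_of: "sets (borel_of T) = sigma_sets (topspace T) {U. openin T U}"
  unfolding borel_of_def by (rule sets_measure_of) (auto dest: openin_subset)

lemma openin_coord:
  assumes "h \<in> carrier G"
  shows "openin (shift_topology G) {w \<in> carrier G \<rightarrow>\<^sub>E UNIV. w h = b}"
proof -
  have "continuous_map (shift_topology G) (discrete_topology UNIV) (\<lambda>w. w h)"
    unfolding shift_topology_def using assms by (rule continuous_map_product_projection)
  from openin_continuous_map_preimage[OF this, of "{b}"] show ?thesis
    by (simp add: topspace_shift)
qed

lemma second_countable_shift:
  assumes "countable (carrier G)"
  shows "second_countable (shift_topology G)"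
  unfolding second_countable_def
proof (intro exI conjI allI impI ballI)
  let ?C = "{F. finite F \<and> F \<subseteq> carrier G}"
  let ?B = "\<lambda>(F, A). {w \<in> carrier G \<rightarrow>\<^sub>E UNIV. \<forall>h\<in>F. w h \<longleftrightarrow> h \<in> A}"
  show "countable (?B ` (?C \<times> ?C))"
    using countable_Collect_finite_subset[OF assms] by (auto intro!: countable_image countable_SIGMA)
  show "openin (shift_topology G) V" if "V \<in> ?B ` (?C \<times> ?C)" for V
  proof -
    from that obtain F A where F: "finite F" "F \<subseteq> carrier G" and V: "V = ?B (F, A)" by auto
    have "V = topspace (shift_topology G) \<inter> \<Inter> ((\<lambda>h. {w \<in> carrier G \<rightarrow>\<^sub>E UNIV. w h = (h \<in> A)}) ` F)"
      by (auto simp: V topspace_shift)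
    moreover have "openin (shift_topology G) \<dots>"
      using F by (intro openin_Int_Inter) (auto intro!: openin_coord)
    ultimately show ?thesis by simp
  qed
  fix U w assume "openin (shift_topology G) U \<and> w \<in> U"
  then obtain W where W: "finite {i \<in> carrier G. W i \<noteq> UNIV}" "w \<in> Pi\<^sub>E (carrier G) W" "Pi\<^sub>E (carrier G) W \<subseteq> U"
    unfolding shift_topology_def openin_product_topology_alt by auto
  let ?F = "{i \<in> carrier G. W i \<noteq> UNIV}" let ?A = "{i \<in> ?F. w i}"
  have "?F \<in> ?C" "?A \<in> ?C" using W(1) by (auto intro: rev_finite_subset)
  then have "?B (?F, ?A) \<in> ?B ` (?C \<times> ?C)" by (intro imageI SigmaI)
  moreover have "w \<in> ?B (?F, ?A)" using W(2) by auto
  moreover have "?B (?F, ?A) \<subseteq> U"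
  proof (rule subset_trans[OF subsetI W(3)])
    fix v assume v: "v \<in> ?B (?F, ?A)"
    have "v i \<in> W i" if i: "i \<in> carrier G" for i
    proof (cases "W i = UNIV")
      case False
      then have "v i = w i" using v i by auto
      then show ?thesis using W(2) i by auto
    qed simp
    then show "v \<in> Pi\<^sub>E (carrier G) W" using v by auto
  qed
  ultimately show "\<exists>V\<in>?B ` (?C \<times> ?C). w \<in> V \<and> V \<subseteq> U" by (intro bexI conjI)
qed

lemma gdelta_in_free_part:
  assumes "group G" "countable (carrier G)"
  shows "gdelta_in (shift_topology G) (free_part G)"
proof -
  interpret group G by (rule assms(1))
  let ?O = "\<lambda>g. \<Union>h\<in>carrier G. \<Union>b. {w \<in> carrier G \<rightarrow>\<^sub>E UNIV. w h = b} \<inter> {w \<in> carrier G \<rightarrow>\<^sub>E UNIV. w (inv\<^bsub>G\<^esub> g \<otimes>\<^bsub>G\<^esub> h) = (\<not> b)}"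
  have op: "openin (shift_topology G) (?O g)" if "g \<in> carrier G" for g
    using that by (intro openin_clauses(3) openin_Union ballI openin_Int) (auto intro!: openin_coord openin_Int)
  have eq: "free_part G = \<Inter> (insert (topspace (shift_topology G)) (?O ` (carrier G - {\<one>\<^bsub>G\<^esub>})))" (is "_ = ?R")
  proof (intro Set.set_eqI)
    fix w
    have ne: "shift G g w \<noteq> w \<longleftrightarrow> w \<in> ?O g" if w: "w \<in> carrier G \<rightarrow>\<^sub>E UNIV" for g
    proof -
      have "shift G g w = w \<longleftrightarrow> (\<forall>h\<in>carrier G. w (inv\<^bsub>G\<^esub> g \<otimes>\<^bsub>G\<^esub> h) = w h)"
        using w by (auto simp: shift_def fun_eq_iff PiE_def extensional_def restrict_def)
      then show ?thesis using w by auto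
    qed
    show "w \<in> free_part G \<longleftrightarrow> w \<in> ?R"
    proof (cases "w \<in> carrier G \<rightarrow>\<^sub>E UNIV")
      case True
      have "w \<in> free_part G \<longleftrightarrow> (\<forall>g\<in>carrier G - {\<one>\<^bsub>G\<^esub>}. shift G g w \<noteq> w)"
        using True by (auto simp: free_part_def)
      also have "\<dots> \<longleftrightarrow> w \<in> ?R"
        unfolding ne[OF True] using True by (simp add: topspace_shift)
      finally show ?thesis .
    qed (simp add: free_part_def topspace_shift)
  qed
  show ?thesis unfolding eq
    using assms(2) op by (intro gdelta_in_Inter) (auto intro: open_imp_gdelta_in)
qed

lemma standard_borel_space_free_part:
  assumes "group G" "countable (carrier G)"
  shows "standard_borel_space (free_part_borel G)"
  unfolding standard_borel_space_def
proof (intro exI conjI)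
  let ?T = "subtopology (shift_topology G) (free_part G)"
  have "completely_metrizable_space (shift_topology G)"
    using assms(2) unfolding shift_topology_def
    by (auto simp: completely_metrizable_space_product_topology completely_metrizable_space_discrete_topology
        intro: countable_subset)
  then show "polish_topology ?T"
    unfolding polish_topology_def
    using second_countable_shift[OF assms(2)] gdelta_in_free_part[OF assms]
    by (auto intro: completely_metrizable_space_gdelta_in second_countable_subtopology)
  show "topspace ?T = space (free_part_borel G)" using free_part_subset[of G] by (auto simp: space_free_part)
  show "sets (free_part_borel G) = sets (borel_of ?T)" by (simp add: free_part_borel_def)
qed

lemma shift_shift: assumes "group G" "g \<in> carrier G" "k \<in> carrier G"
  shows "shift G g (shift G k w) = shift G (g \<otimes>\<^bsub>G\<^esub> k) w"
proof -
  interpret group G by (rule assms(1))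
  show ?thesis using assms by (auto simp: shift_def fun_eq_iff inv_mult_group m_assoc)
qed

lemma shift_one: assumes "group G" "w \<in> carrier G \<rightarrow>\<^sub>E UNIV"
  shows "shift G \<one>\<^bsub>G\<^esub> w = w"
proof -
  interpret group G by (rule assms(1))
  show ?thesis using assms by (auto simp: shift_def fun_eq_iff PiE_def extensional_def)
qed

lemma shift_free: assumes "group G" "g \<in> carrier G" "w \<in> free_part G"
  shows "shift G g w \<in> free_part G"
proof -
  interpret group G by (rule assms(1))
  have w: "w \<in> carrier G \<rightarrow>\<^sub>E UNIV" using assms by (auto simp: free_part_def)
  have "shift G k (shift G g w) \<noteq> shift G g w" if k: "k \<in> carrier G" "k \<noteq> \<one>\<^bsub>G\<^esub>" for k
  proof
    assume "shift G k (shift G g w) = shift G g w"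
    then have "shift G (inv\<^bsub>G\<^esub> g) (shift G k (shift G g w)) = shift G (inv\<^bsub>G\<^esub> g) (shift G g w)" by simp
    then have "shift G (inv\<^bsub>G\<^esub> g \<otimes>\<^bsub>G\<^esub> k \<otimes>\<^bsub>G\<^esub> g) w = w"
      using assms k w by (simp add: shift_shift shift_one m_assoc)
    moreover have "inv\<^bsub>G\<^esub> g \<otimes>\<^bsub>G\<^esub> k \<otimes>\<^bsub>G\<^esub> g \<noteq> \<one>\<^bsub>G\<^esub>"
    proof
      assume "inv\<^bsub>G\<^esub> g \<otimes>\<^bsub>G\<^esub> k \<otimes>\<^bsub>G\<^esub> g = \<one>\<^bsub>G\<^esub>"
      then have "inv\<^bsub>G\<^esub> g \<otimes>\<^bsub>G\<^esub> k = inv\<^bsub>G\<^esub> g"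
        using assms(2) k(1) by (intro inv_equality[symmetric]) auto
      then have "k = \<one>\<^bsub>G\<^esub>"
        using assms(2) k(1) by simp
      then show False using k(2) by simp
    qed
    ultimately show False using assms k unfolding free_part_def by auto
  qed
  then show ?thesis using w by (auto simp: free_part_def shift_def)
qed

lemma measurable_coord: assumes "h \<in> carrier G"
  shows "(\<lambda>w. w h) \<in> free_part_borel G \<rightarrow>\<^sub>M count_space UNIV"
proof (rule measurableI)
  fix A :: "bool set"
  have "{w \<in> carrier G \<rightarrow>\<^sub>E UNIV. w h = b} \<inter> free_part G \<in> sets (free_part_borel G)" for b
    unfolding free_part_borel_def sets_borel_of
    by (intro sigma_sets.Basic) (auto simp: openin_subtopology intro: openin_coord[OF assms])
  then have "(\<Union>b\<in>A. {w \<in> carrier G \<rightarrow>\<^sub>E UNIV. w h = b} \<inter> free_part G) \<in> sets (free_part_borel G)"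
    by (intro sets.countable_UN'') auto
  also have "(\<Union>b\<in>A. {w \<in> carrier G \<rightarrow>\<^sub>E UNIV. w h = b} \<inter> free_part G) = (\<lambda>w. w h) -` A \<inter> space (free_part_borel G)"
    by (auto simp: space_free_part free_part_def)
  finally show "(\<lambda>w. w h) -` A \<inter> space (free_part_borel G) \<in> sets (free_part_borel G)" .
qed simp

lemma countable_borel_equiv_rel_F2:
  assumes "group G" "countable (carrier G)"
  shows "countable_borel_equiv_rel (free_part_borel G) (F2 G)"
proof -
  interpret group G by (rule assms(1))
  have F2: "F2 G = {(x, y). x \<in> free_part G \<and> (\<exists>g\<in>carrier G. y = shift G g x)}"
    by (auto simp: F2_def orbit_equiv_rel_def orbit_def)
  have ext: "x \<in> carrier G \<rightarrow>\<^sub>E UNIV" if "x \<in> free_part G" for x using that by (simp add: free_part_def)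
  have "equiv (free_part G) (F2 G)"
  proof (rule equivI)
    show "F2 G \<subseteq> free_part G \<times> free_part G" using shift_free[OF assms(1)] by (auto simp: F2)
    show "refl_on (free_part G) (F2 G)" unfolding F2 refl_on_def
      using shift_one[OF assms(1), OF ext, symmetric] one_closed by blast
    show "sym (F2 G)"
    proof (rule symI)
      fix x y assume "(x, y) \<in> F2 G"
      then obtain g where g: "x \<in> free_part G" "g \<in> carrier G" "y = shift G g x" by (auto simp: F2)
      then have "x = shift G (inv\<^bsub>G\<^esub> g) y" "y \<in> free_part G"
        using shift_free[OF assms(1)] by (simp_all add: shift_shift[OF assms(1)] shift_one[OF assms(1)] ext)
      then show "(y, x) \<in> F2 G" using g by (auto simp: F2)
    qed
    show "trans (F2 G)"
    proof (rule transI)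
      fix x y z assume "(x, y) \<in> F2 G" "(y, z) \<in> F2 G"
      then obtain g k where "x \<in> free_part G" "g \<in> carrier G" "k \<in> carrier G" "z = shift G k (shift G g x)"
        by (auto simp: F2)
      then show "(x, z) \<in> F2 G" using m_closed[of k g] by (auto simp: F2 shift_shift[OF assms(1)])
    qed
  qed
  moreover have "F2 G \<in> sets (free_part_borel G \<Otimes>\<^sub>M free_part_borel G)" (is "_ \<in> sets ?P")
  proof -
    have [measurable]: "(\<lambda>p. fst p h) \<in> ?P \<rightarrow>\<^sub>M count_space UNIV" "(\<lambda>p. snd p h) \<in> ?P \<rightarrow>\<^sub>M count_space UNIV"
      if "h \<in> carrier G" for h
      using measurable_coord[OF that] by measurable
    have eq: "F2 G = {p \<in> space ?P. \<exists>g\<in>carrier G. \<forall>h\<in>carrier G. snd p h = fst p (inv\<^bsub>G\<^esub> g \<otimes>\<^bsub>G\<^esub> h)}" (is "_ = ?S")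
    proof (rule Set.set_eqI, rename_tac p, case_tac p, simp only:)
      fix x y :: "'a \<Rightarrow> bool"
      have "y = shift G g x \<longleftrightarrow> (\<forall>h\<in>carrier G. y h = x (inv\<^bsub>G\<^esub> g \<otimes>\<^bsub>G\<^esub> h))" if "y \<in> free_part G" for g
        using ext[OF that] by (auto simp: shift_def fun_eq_iff PiE_def extensional_def)
      moreover have "y \<in> free_part G" if "(x, y) \<in> F2 G" using that shift_free[OF assms(1)] by (auto simp: F2)
      ultimately show "(x, y) \<in> F2 G \<longleftrightarrow> (x, y) \<in> ?S"
        by (auto simp: F2 space_pair_measure space_free_part)
    qed
    show ?thesis unfolding eq
      using assms(2) by (intro sets.sets_Collect_countable_Ex' sets.sets_Collect_countable_All') (auto intro!: measurable_equality_set)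
  qed
  moreover have "countable (F2 G `` {x})" for x
  proof (rule countable_subset)
    show "F2 G `` {x} \<subseteq> (\<lambda>g. shift G g x) ` carrier G" by (auto simp: F2)
  qed (use assms in simp)
  ultimately show ?thesis by (simp add: countable_borel_equiv_rel_def space_free_part)
qed

end

theory Submission
  imports Defs
begin

text \<open>
  It suffices to find, for a free Borel action on \<open>X\<close>, an equivariant Borel map into the free part
  of the shift: it is injective on orbits, so a structuring of \<open>F(G,2)\<close> pulls back. Such a map is
  \<open>x \<mapsto> (g \<mapsto> g\<inverse> x \<in> M)\<close> for a Borel set \<open>M\<close> such that for all \<open>x\<close> and \<open>\<gamma> \<noteq> 1\<close> some \<open>h\<close> satisfies
  \<open>h x \<in> M \<longleftrightarrow> h \<gamma> x \<notin> M\<close>.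

  The set \<open>M\<close> is an increasing union, one stage for each \<open>\<gamma>\<close>, and a growing Borel set \<open>Z\<close> with
  syndetic complement records the points whose membership in \<open>M\<close> is settled. A stage fixes a large finite
  \<open>A \<subseteq> G\<close> and a maximal Borel set \<open>S\<close> of well separated markers, and settles \<open>A m\<close> for each
  marker \<open>m\<close> by adding a tuple of unsettled points of \<open>A m\<close> to \<open>M\<close>, the code of \<open>m\<close>. Every \<open>x\<close> has a
  translate \<open>d x = m\<close> in \<open>S\<close>, and then \<open>d \<gamma> x = c m\<close> for one of polynomially many (in \<open>|A|\<close>) elements \<open>c\<close>.
  The codes are chosen, by recursion along a Borel colouring, so that the pattern of \<open>M\<close> on \<open>A m\<close>
  never recurs on \<open>A c m\<close>: all but a few points of \<open>M \<inter> A c m\<close> come from earlier stages or from the code of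
  a single marker, later stages contributing at most one point because their points are kept far apart.
  Since few tuples share many entries with a prescribed set, counting yields a good code.
\<close>

section \<open>Borel functions with countable range\<close>

text \<open>Measurability into a discrete space, with countable range, so that every preimage is
  Borel. The value type is arbitrary: colours, finite sets, codes and partial functions all occur as
  values, and any operation may be applied to them.\<close>

definition countable_borel_fun :: "'x measure \<Rightarrow> ('x \<Rightarrow> 'v) \<Rightarrow> bool"
  where "countable_borel_fun X f \<longleftrightarrow>
    countable (f ` space X) \<and> (\<forall>v. {x \<in> space X. f x = v} \<in> sets X)"

lemma countable_borel_fun_sets:
  assumes "countable_borel_fun X f"
  shows "{x \<in> space X. P (f x)} \<in> sets X"
proof -
  have "{x \<in> space X. P (f x)} = (\<Union>v\<in>{v \<in> f ` space X. P v}. {x \<in> space X. f x = v})"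
    by auto
  also have "\<dots> \<in> sets X"
  proof (rule sets.countable_UN'')
    show "countable {v \<in> f ` space X. P v}"
      using assms by (auto simp: countable_borel_fun_def)
  qed (use assms in \<open>auto simp: countable_borel_fun_def\<close>)
  finally show ?thesis .
qed

lemma countable_borel_fun_bool:
  "countable_borel_fun X P \<longleftrightarrow> {x \<in> space X. P x} \<in> sets X"
proof
  assume P: "{x \<in> space X. P x} \<in> sets X"
  have "{x \<in> space X. P x = v} \<in> sets X" for v
  proof (cases v)
    case False
    then have "{x \<in> space X. P x = v} = space X - {x \<in> space X. P x}" by auto
    then show ?thesis using P by simp
  qed (use P in simp)
  then show "countable_borel_fun X P"
    unfolding countable_borel_fun_def by auto
next
  assume "countable_borel_fun X P"
  from countable_borel_fun_sets[OF this, of "\<lambda>b. b"] show "{x \<in> space X. P x} \<in> sets X" .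
qed

lemma countable_borel_fun_mem: "A \<in> sets X \<Longrightarrow> countable_borel_fun X (\<lambda>x. x \<in> A)"
proof -
  assume "A \<in> sets X"
  moreover have "{x \<in> space X. x \<in> A} = A" using sets.sets_into_space[OF \<open>A \<in> sets X\<close>] by auto
  ultimately show ?thesis by (simp add: countable_borel_fun_bool)
qed

lemma countable_borel_fun_const: "countable_borel_fun X (\<lambda>x. c)"
  unfolding countable_borel_fun_def by (cases "space X = {}") (auto simp: image_constant_conv)

lemma countable_borel_fun_comp:
  assumes "countable_borel_fun X f"
  shows "countable_borel_fun X (\<lambda>x. h (f x))"
  unfolding countable_borel_fun_def
proof
  have "(\<lambda>x. h (f x)) ` space X = h ` f ` space X" by auto
  then show "countable ((\<lambda>x. h (f x)) ` space X)"
    using assms by (auto simp: countable_borel_fun_def)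
  show "\<forall>v. {x \<in> space X. h (f x) = v} \<in> sets X"
    using countable_borel_fun_sets[OF assms] by auto
qed

lemma countable_borel_fun_Pair:
  assumes "countable_borel_fun X f" "countable_borel_fun X g"
  shows "countable_borel_fun X (\<lambda>x. (f x, g x))"
  unfolding countable_borel_fun_def
proof
  have "(\<lambda>x. (f x, g x)) ` space X \<subseteq> f ` space X \<times> g ` space X" by auto
  then show "countable ((\<lambda>x. (f x, g x)) ` space X)"
    using assms by (rule_tac countable_subset) (auto simp: countable_borel_fun_def)
  show "\<forall>v. {x \<in> space X. (f x, g x) = v} \<in> sets X"
  proof
    fix v
    have "{x \<in> space X. (f x, g x) = v} = {x \<in> space X. f x = fst v} \<inter> {x \<in> space X. g x = snd v}"
      by auto
    then show "{x \<in> space X. (f x, g x) = v} \<in> sets X"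
      using assms by (auto simp: countable_borel_fun_def)
  qed
qed

lemma countable_borel_fun_comp2:
  assumes "countable_borel_fun X f" "countable_borel_fun X g"
  shows "countable_borel_fun X (\<lambda>x. h (f x) (g x))"
  using countable_borel_fun_comp[OF countable_borel_fun_Pair[OF assms], of "case_prod h"] by simp

text \<open>Updating one coordinate at a time keeps the range countable; the fixed default
  \<open>d\<close> off the finite set \<open>I\<close> makes the value a total function.\<close>

lemma countable_borel_fun_family:
  assumes "finite I" "\<And>i. i \<in> I \<Longrightarrow> countable_borel_fun X (f i)"
  shows "countable_borel_fun X (\<lambda>x i. if i \<in> I then f i x else d)"
  using assms
proof (induction I)
  case empty
  then show ?case by (simp add: countable_borel_fun_const)
next
  case (insert j I)
  have "countable_borel_fun X (\<lambda>x. (\<lambda>i. if i \<in> I then f i x else d)(j := f j x))"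
    using insert by (intro countable_borel_fun_comp2[where h = "\<lambda>F y. F(j := y)"]) auto
  also have "(\<lambda>x. (\<lambda>i. if i \<in> I then f i x else d)(j := f j x)) =
      (\<lambda>x i. if i \<in> insert j I then f i x else d)"
    by (auto simp: fun_eq_iff)
  finally show ?case .
qed

lemma countable_borel_fun_subset:
  assumes "finite A" "\<And>a. a \<in> A \<Longrightarrow> countable_borel_fun X (P a)"
  shows "countable_borel_fun X (\<lambda>x. {a \<in> A. P a x})"
proof -
  have eq: "{a \<in> A. P a x} = {a. if a \<in> A then P a x else False}" for x by auto
  show ?thesis unfolding eq
    using countable_borel_fun_comp[OF countable_borel_fun_family[OF assms], where h = "\<lambda>F. {a. F a}"] .
qed

lemma countable_borel_fun_compose_measurable:
  assumes "countable_borel_fun X f" "T \<in> X \<rightarrow>\<^sub>M X"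
  shows "countable_borel_fun X (\<lambda>x. f (T x))"
  unfolding countable_borel_fun_def
proof
  have "(\<lambda>x. f (T x)) ` space X \<subseteq> f ` space X"
    using measurable_space[OF assms(2)] by auto
  then show "countable ((\<lambda>x. f (T x)) ` space X)"
    using assms by (auto simp: countable_borel_fun_def intro: countable_subset)
  show "\<forall>v. {x \<in> space X. f (T x) = v} \<in> sets X"
  proof
    fix v
    have "{x \<in> space X. f (T x) = v} = T -` {x \<in> space X. f x = v} \<inter> space X"
      using measurable_space[OF assms(2)] by auto
    then show "{x \<in> space X. f (T x) = v} \<in> sets X"
      using assms by (auto simp: countable_borel_fun_def)
  qed
qed

lemma (in group) mult_inv_cancel:
  assumes "g \<in> carrier G" "h \<in> carrier G"
  shows "g \<otimes> (inv g \<otimes> h) = h" "inv g \<otimes> (g \<otimes> h) = h"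
  using assms by (simp_all flip: m_assoc)

section \<open>Borel colourings and recursion along a colouring\<close>

text \<open>Standard Borelness enters through a countable family of Borel sets that separates
  points.\<close>

locale free_borel_action = group G for G :: "('g, 'm) monoid_scheme" (structure) +
  fixes X :: "'x measure" and \<phi> :: "'g \<Rightarrow> 'x \<Rightarrow> 'x"
  assumes infinite_carrier: "infinite (carrier G)"
    and act_closed: "\<lbrakk>g \<in> carrier G; x \<in> space X\<rbrakk> \<Longrightarrow> \<phi> g x \<in> space X"
    and act_mult: "\<lbrakk>g \<in> carrier G; h \<in> carrier G; x \<in> space X\<rbrakk> \<Longrightarrow> \<phi> g (\<phi> h x) = \<phi> (g \<otimes> h) x"
    and act_one: "x \<in> space X \<Longrightarrow> \<phi> \<one> x = x"
    and act_measurable: "g \<in> carrier G \<Longrightarrow> \<phi> g \<in> X \<rightarrow>\<^sub>M X"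
    and act_free: "\<lbrakk>g \<in> carrier G; x \<in> space X; \<phi> g x = x\<rbrakk> \<Longrightarrow> g = \<one>"
    and separating: "\<exists>U :: nat \<Rightarrow> 'x set. range U \<subseteq> sets X \<and>
      (\<forall>x\<in>space X. \<forall>y\<in>space X. x \<noteq> y \<longrightarrow> (\<exists>n. x \<in> U n \<longleftrightarrow> y \<notin> U n))"
begin

lemma act_cancel:
  assumes "g \<in> carrier G" "h \<in> carrier G" "x \<in> space X" "\<phi> g x = \<phi> h x"
  shows "g = h"
proof -
  have "\<phi> (inv h \<otimes> g) x = x"
    using assms by (simp flip: act_mult) (simp add: act_mult act_one)
  then have "inv h \<otimes> g = \<one>" using act_free assms by simp
  then show ?thesis using assms by (metis inv_closed inv_equality inv_inv)
qed

lemma act_inv_act [simp]: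
  "\<lbrakk>g \<in> carrier G; x \<in> space X\<rbrakk> \<Longrightarrow> \<phi> (inv g) (\<phi> g x) = x"
  "\<lbrakk>g \<in> carrier G; x \<in> space X\<rbrakk> \<Longrightarrow> \<phi> g (\<phi> (inv g) x) = x"
  by (simp_all add: act_mult act_one)

lemma countable_borel_fun_translate:
  "\<lbrakk>countable_borel_fun X f; g \<in> carrier G\<rbrakk> \<Longrightarrow> countable_borel_fun X (\<lambda>x. f (\<phi> g x))"
  by (rule countable_borel_fun_compose_measurable[OF _ act_measurable])

text \<open>By freeness \<open>x\<close> and \<open>g x\<close> differ, so some \<open>U n\<close>
  separates them. The colour records the least such \<open>n\<close> and the side of
  \<open>x\<close>: equal colours at \<open>x\<close> and \<open>g x\<close> would put both points
  on the same side of the same \<open>U n\<close>.\<close>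

lemma borel_colouring_single:
  assumes g: "g \<in> carrier G" "g \<noteq> \<one>"
  shows "\<exists>\<kappa>::'x \<Rightarrow> nat. countable_borel_fun X \<kappa> \<and> (\<forall>x\<in>space X. \<kappa> (\<phi> g x) \<noteq> \<kappa> x)"
proof -
  obtain U :: "nat \<Rightarrow> 'x set" where "range U \<subseteq> sets X \<and>
      (\<forall>x\<in>space X. \<forall>y\<in>space X. x \<noteq> y \<longrightarrow> (\<exists>n. x \<in> U n \<longleftrightarrow> y \<notin> U n))"
    using separating by (elim exE)
  then have U: "range U \<subseteq> sets X"
    and sep: "\<And>x y. \<lbrakk>x \<in> space X; y \<in> space X; x \<noteq> y\<rbrakk> \<Longrightarrow> \<exists>n. x \<in> U n \<longleftrightarrow> y \<notin> U n"
    by simp_all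
  define \<nu> where "\<nu> x = (LEAST n. x \<in> U n \<longleftrightarrow> \<phi> g x \<notin> U n)" for x
  have ex: "\<exists>n. x \<in> U n \<longleftrightarrow> \<phi> g x \<notin> U n" if "x \<in> space X" for x
    using sep[of x "\<phi> g x"] act_free[of g x] act_closed[of g x] that g by metis
  have split: "x \<in> U (\<nu> x) \<longleftrightarrow> \<phi> g x \<notin> U (\<nu> x)" if "x \<in> space X" for x
    unfolding \<nu>_def by (rule LeastI_ex[OF ex[OF that]])
  have mem: "countable_borel_fun X (\<lambda>x. x \<in> U n)" for n
    using U by (intro countable_borel_fun_mem) auto
  have diff: "countable_borel_fun X (\<lambda>x. x \<in> U n \<longleftrightarrow> \<phi> g x \<notin> U n)" for n
    using countable_borel_fun_comp2[OF mem[of n] countable_borel_fun_translate[OF mem[of n] g(1)],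
        where h = "\<lambda>a b. a \<longleftrightarrow> \<not> b"] .
  have \<nu>: "countable_borel_fun X \<nu>"
    unfolding countable_borel_fun_def
  proof (intro conjI allI)
    fix n
    have eq: "{x \<in> space X. \<nu> x = n} = {x \<in> space X. x \<in> U n \<longleftrightarrow> \<phi> g x \<notin> U n} -
        (\<Union>m\<in>{..<n}. {x \<in> space X. x \<in> U m \<longleftrightarrow> \<phi> g x \<notin> U m})" (is "?L = ?R")
    proof (intro Set.set_eqI iffI)
      fix x assume x: "x \<in> ?L"
      then have "\<not> (x \<in> U m \<longleftrightarrow> \<phi> g x \<notin> U m)" if "m < n" for m
        using not_less_Least[of m "\<lambda>n. x \<in> U n \<longleftrightarrow> \<phi> g x \<notin> U n"] that by (simp add: \<nu>_def)
      then show "x \<in> ?R" using x split[of x] by auto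
    next
      fix x assume x: "x \<in> ?R"
      have "\<nu> x = n" unfolding \<nu>_def
      proof (rule Least_equality)
        show "x \<in> U n \<longleftrightarrow> \<phi> g x \<notin> U n" using x by blast
        fix m assume "x \<in> U m \<longleftrightarrow> \<phi> g x \<notin> U m"
        then show "n \<le> m" using x by (cases "m < n") auto
      qed
      then show "x \<in> ?L" using x by auto
    qed
    show "{x \<in> space X. \<nu> x = n} \<in> sets X"
      unfolding eq using diff by (intro sets.Diff sets.finite_UN) (auto simp: countable_borel_fun_bool)
  qed simp
  have "{x \<in> space X. x \<in> U (\<nu> x)} = (\<Union>n. {x \<in> space X. \<nu> x = n} \<inter> {x \<in> space X. x \<in> U n})"
    by auto
  also have "\<dots> \<in> sets X"
  proof (rule sets.countable_UN'')
    fix n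
    show "{x \<in> space X. \<nu> x = n} \<inter> {x \<in> space X. x \<in> U n} \<in> sets X"
      using \<nu> countable_borel_fun_bool[THEN iffD1, OF mem[of n]] unfolding countable_borel_fun_def
      by (intro sets.Int) simp_all
  qed simp
  finally have "countable_borel_fun X (\<lambda>x. x \<in> U (\<nu> x))" by (simp add: countable_borel_fun_bool)
  from countable_borel_fun_comp2[OF \<nu> this, where h = "\<lambda>n b. 2 * n + of_bool b"]
  have "countable_borel_fun X (\<lambda>x. 2 * \<nu> x + of_bool (x \<in> U (\<nu> x)))" .
  moreover have "2 * \<nu> (\<phi> g x) + of_bool (\<phi> g x \<in> U (\<nu> (\<phi> g x))) \<noteq>
      2 * \<nu> x + of_bool (x \<in> U (\<nu> x))" if x: "x \<in> space X" for x
  proof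
    assume eq: "2 * \<nu> (\<phi> g x) + of_bool (\<phi> g x \<in> U (\<nu> (\<phi> g x))) = 2 * \<nu> x + of_bool (x \<in> U (\<nu> x))"
    then have "\<nu> (\<phi> g x) = \<nu> x" by (cases "x \<in> U (\<nu> x)"; cases "\<phi> g x \<in> U (\<nu> (\<phi> g x))"; simp; presburger)
    with eq have "\<phi> g x \<in> U (\<nu> x) \<longleftrightarrow> x \<in> U (\<nu> x)" by (auto simp: of_bool_def split: if_splits)
    with split[OF x] show False by blast
  qed
  ultimately show ?thesis by blast
qed

lemma borel_colouring:
  assumes "finite F" "F \<subseteq> carrier G"
  shows "\<exists>\<kappa>::'x \<Rightarrow> nat. countable_borel_fun X \<kappa> \<and>
    (\<forall>g\<in>F. g \<noteq> \<one> \<longrightarrow> (\<forall>x\<in>space X. \<kappa> (\<phi> g x) \<noteq> \<kappa> x))"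
  using assms
proof (induction F)
  case empty
  then show ?case using countable_borel_fun_const[of X "0::nat"] by auto
next
  case (insert g F)
  then obtain \<kappa> :: "'x \<Rightarrow> nat" where \<kappa>: "countable_borel_fun X \<kappa>"
      "\<forall>g\<in>F. g \<noteq> \<one> \<longrightarrow> (\<forall>x\<in>space X. \<kappa> (\<phi> g x) \<noteq> \<kappa> x)" by auto
  show ?case
  proof (cases "g = \<one>")
    case False
    then obtain \<kappa>' :: "'x \<Rightarrow> nat" where \<kappa>': "countable_borel_fun X \<kappa>'"
        "\<forall>x\<in>space X. \<kappa>' (\<phi> g x) \<noteq> \<kappa>' x"
      using borel_colouring_single insert.prems by blast
    have "countable_borel_fun X (\<lambda>x. prod_encode (\<kappa> x, \<kappa>' x))"
      using countable_borel_fun_comp2[OF \<kappa>(1) \<kappa>'(1), where h = "\<lambda>a b. prod_encode (a, b)"] .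
    then show ?thesis using \<kappa>(2) \<kappa>'(2) by (intro exI[of _ "\<lambda>x. prod_encode (\<kappa> x, \<kappa>' x)"]) auto
  qed (use \<kappa> in auto)
qed

text \<open>The value at \<open>x\<close> refers only to values at \<open>F\<close>-translates of
  smaller colour, so it is computed colour by colour. Each colour uses finitely many earlier values
  and the local data \<open>\<delta> x\<close>, which keeps fibres Borel, and the colour classes cut
  \<open>X\<close> into countably many Borel pieces.\<close>

lemma borel_recursion:
  fixes \<kappa> :: "'x \<Rightarrow> nat" and step :: "'d \<Rightarrow> ('g \<Rightarrow> 'v option) \<Rightarrow> 'v"
  assumes \<kappa>: "countable_borel_fun X \<kappa>" and \<delta>: "countable_borel_fun X \<delta>"
    and F: "finite F" "F \<subseteq> carrier G"
  shows "\<exists>u. countable_borel_fun X u \<and>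
    (\<forall>x\<in>space X. u x = step (\<delta> x)
      (\<lambda>g. if g \<in> F then if \<kappa> (\<phi> g x) < \<kappa> x then Some (u (\<phi> g x)) else None else None))"
proof -
  define next_level where "next_level n u x =
    (if \<kappa> x = n then step (\<delta> x)
      (\<lambda>g. if g \<in> F then if \<kappa> (\<phi> g x) < \<kappa> x then Some (u (\<phi> g x)) else None else None) else u x)"
    for n :: nat and u x
  define level where "level = rec_nat (\<lambda>_. undefined) next_level"
  have level_Suc: "level (Suc n) = next_level n (level n)" for n by (simp add: level_def)
  have cbf: "countable_borel_fun X (level n)" for n
  proof (induction n)
    case 0
    then show ?case by (simp add: level_def countable_borel_fun_const)
  next
    case (Suc n)
    have "countable_borel_fun X (\<lambda>x. if \<kappa> (\<phi> g x) < \<kappa> x then Some (level n (\<phi> g x)) else None)"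
      if "g \<in> F" for g
    proof -
      have g: "g \<in> carrier G" using that F by auto
      have "countable_borel_fun X (\<lambda>x. \<kappa> (\<phi> g x) < \<kappa> x)"
        using countable_borel_fun_comp2[OF countable_borel_fun_translate[OF \<kappa> g] \<kappa>, where h = "(<)"] .
      from countable_borel_fun_comp2[OF this countable_borel_fun_translate[OF Suc g], where h = "\<lambda>b v. if b then Some v else None"]
      show ?thesis .
    qed
    from countable_borel_fun_family[OF F(1) this] have fam: "countable_borel_fun X (\<lambda>x g. if g \<in> F then
        if \<kappa> (\<phi> g x) < \<kappa> x then Some (level n (\<phi> g x)) else None else None)" .
    have "countable_borel_fun X (\<lambda>x. if \<kappa> x = n then f x else level n x)"
      if "countable_borel_fun X f" for f
      using countable_borel_fun_comp2[OF countable_borel_fun_Pair[OF \<kappa> that] Suc,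
          where h = "\<lambda>p v'. if fst p = n then snd p else v'"] by (simp cong: if_cong)
    from this[OF countable_borel_fun_comp2[OF \<delta> fam, where h = step]] show ?case
      unfolding level_Suc next_level_def[abs_def] .
  qed
  \<comment> \<open>\<open>level n\<close> is final at points of colour below \<open>n\<close>,
    hence the \<open>Suc\<close>.\<close>
  define u where "u x = level (Suc (\<kappa> x)) x" for x
  have level: "level n x = u x" if "\<kappa> x < n" for n x
    using that
  proof (induction n)
    case (Suc n)
    then show ?case
      by (cases "\<kappa> x = n") (auto simp: u_def level_Suc[of n] next_level_def)
  qed simp
  have "u x = step (\<delta> x)
      (\<lambda>g. if g \<in> F then if \<kappa> (\<phi> g x) < \<kappa> x then Some (u (\<phi> g x)) else None else None)" for x
    unfolding u_def[of x] level_Suc next_level_def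
    by (simp add: level cong: if_cong)
  moreover have "countable_borel_fun X u"
    unfolding countable_borel_fun_def
  proof (intro conjI allI)
    have "u ` space X \<subseteq> (\<Union>n. level n ` space X)" by (auto simp: u_def)
    then show "countable (u ` space X)"
      using cbf by (rule_tac countable_subset) (auto simp: countable_borel_fun_def)
    fix v
    have "{x \<in> space X. u x = v} =
        (\<Union>n. {x \<in> space X. \<kappa> x = n} \<inter> {x \<in> space X. level (Suc n) x = v})"
      by (auto simp: u_def)
    also have "\<dots> \<in> sets X"
      using \<kappa> cbf by (intro sets.countable_UN) (auto simp: countable_borel_fun_def)
    finally show "{x \<in> space X. u x = v} \<in> sets X" .
  qed
  ultimately show ?thesis by blast
qed

text \<open>Greedy choice along a Borel colouring: a point joins \<open>S\<close> iff no neighbour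
  of smaller colour has joined. Of two neighbours in \<open>S\<close> the one of larger colour would
  have been rejected, and every rejected point has a neighbour in \<open>S\<close>.\<close>

lemma maximal_discrete:
  assumes D: "finite D" "D \<subseteq> carrier G"
  obtains S where "S \<in> sets X"
    and "\<And>s d. \<lbrakk>s \<in> S; d \<in> D; \<phi> d s \<in> S\<rbrakk> \<Longrightarrow> d = \<one>"
    and "\<And>x. x \<in> space X \<Longrightarrow> \<exists>d \<in> insert \<one> (D \<union> m_inv G ` D). \<phi> d x \<in> S"
proof -
  let ?F = "D \<union> m_inv G ` D - {\<one>}"
  have F: "finite ?F" "?F \<subseteq> carrier G" using D by auto
  obtain \<kappa> :: "'x \<Rightarrow> nat" where \<kappa>: "countable_borel_fun X \<kappa>"
      and \<kappa>_neq: "\<And>g x. \<lbrakk>g \<in> ?F; x \<in> space X\<rbrakk> \<Longrightarrow> \<kappa> (\<phi> g x) \<noteq> \<kappa> x"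
    using borel_colouring[OF F] by blast
  obtain u where u: "countable_borel_fun X u"
    and u_rec: "\<And>x. x \<in> space X \<Longrightarrow> u x = (\<forall>g\<in>?F.
      (if g \<in> ?F then if \<kappa> (\<phi> g x) < \<kappa> x then Some (u (\<phi> g x)) else None else None) \<noteq> Some True)"
    \<comment> \<open>The greedy rule looks at earlier decisions alone, so the local data are a
      dummy constant.\<close>
    using borel_recursion[OF \<kappa> countable_borel_fun_const F, of "\<lambda>_ p. \<forall>g\<in>?F. p g \<noteq> Some True" undefined] by blast
  have u_rec: "u x \<longleftrightarrow> (\<forall>g\<in>?F. \<kappa> (\<phi> g x) < \<kappa> x \<longrightarrow> \<not> u (\<phi> g x))" if "x \<in> space X" for x
    unfolding u_rec[OF that] by auto
  let ?S = "{x \<in> space X. u x}"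
  show ?thesis
  proof
    show "?S \<in> sets X" using u by (simp add: countable_borel_fun_bool)
  next
    fix s d assume s: "s \<in> ?S" "d \<in> D" "\<phi> d s \<in> ?S"
    show "d = \<one>"
    proof (rule ccontr)
      assume d: "d \<noteq> \<one>"
      then have dF: "d \<in> ?F" "inv d \<in> ?F" using s D by auto
      have eq: "\<phi> (inv d) (\<phi> d s) = s" using s D by (auto simp: act_mult act_one)
      have "\<kappa> (\<phi> d s) \<noteq> \<kappa> s" using \<kappa>_neq dF s by blast
      moreover have "\<not> \<kappa> (\<phi> d s) < \<kappa> s" using u_rec[of s] s dF by auto
      moreover have "\<not> \<kappa> s < \<kappa> (\<phi> d s)" using u_rec[of "\<phi> d s"] s dF eq by (metis (no_types, lifting) mem_Collect_eq)
      ultimately show False by linarith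
    qed
  next
    fix x assume x: "x \<in> space X"
    show "\<exists>d \<in> insert \<one> (D \<union> m_inv G ` D). \<phi> d x \<in> ?S"
    proof (cases "u x")
      case True
      then show ?thesis using x by (intro bexI[of _ \<one>]) (auto simp: act_one)
    next
      case False
      then obtain g where "g \<in> ?F" "u (\<phi> g x)" using u_rec[OF x] by blast
      then show ?thesis using x D F(2) by (intro bexI[of _ g]) (auto intro!: act_closed)
    qed
  qed
qed

end

section \<open>Generic tuples\<close>

text \<open>Union bound over the choices of \<open>q\<close> positions that fall in
  \<open>Y\<close>, the remaining positions ranging over \<open>A\<close>.\<close>

lemma card_many_hits_le:
  fixes A Y :: "'a set"
  assumes "finite A" "finite Y" "q \<le> w"
  shows "card {u \<in> {..<w} \<rightarrow>\<^sub>E A. q \<le> card {i \<in> {..<w}. u i \<in> Y}}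
    \<le> (w choose q) * (card Y ^ q * card A ^ (w - q))"
proof -
  let ?I = "{I. I \<subseteq> {..<w} \<and> card I = q}"
  let ?box = "\<lambda>I. \<Pi>\<^sub>E i\<in>{..<w}. if i \<in> I then Y else A"
  have fin: "finite ?I" by (rule finite_subset[of _ "Pow {..<w}"]) auto
  have "{u \<in> {..<w} \<rightarrow>\<^sub>E A. q \<le> card {i \<in> {..<w}. u i \<in> Y}} \<subseteq> (\<Union>I\<in>?I. ?box I)"
  proof
    fix u assume u: "u \<in> {u \<in> {..<w} \<rightarrow>\<^sub>E A. q \<le> card {i \<in> {..<w}. u i \<in> Y}}"
    then obtain I where I: "I \<subseteq> {i \<in> {..<w}. u i \<in> Y}" "card I = q"
      using obtain_subset_with_card_n by (metis (no_types, lifting) mem_Collect_eq)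
    then have "u \<in> ?box I" using u by (auto simp: PiE_iff)
    then show "u \<in> (\<Union>I\<in>?I. ?box I)" using I by blast
  qed
  then have "card {u \<in> {..<w} \<rightarrow>\<^sub>E A. q \<le> card {i \<in> {..<w}. u i \<in> Y}} \<le> card (\<Union>I\<in>?I. ?box I)"
    using fin assms by (intro card_mono) (auto intro!: finite_PiE)
  also have "\<dots> \<le> (\<Sum>I\<in>?I. card (?box I))"
    by (rule card_UN_le[OF fin])
  also have "\<dots> = (\<Sum>I\<in>?I. card Y ^ q * card A ^ (w - q))"
  proof (rule sum.cong[OF refl])
    fix I assume I: "I \<in> ?I"
    then have "finite I" by (auto intro: finite_subset)
    have "card (?box I) = (\<Prod>i<w. if i \<in> I then card Y else card A)"
      by (subst card_PiE) (auto intro!: prod.cong)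
    also have "\<dots> = card Y ^ card ({..<w} \<inter> I) * card A ^ card ({..<w} \<inter> - I)"
      by (subst prod.If_cases) auto
    also have "{..<w} \<inter> I = I" using I by auto
    also have "{..<w} \<inter> - I = {..<w} - I" by auto
    also have "card ({..<w} - I) = w - q" using I \<open>finite I\<close> by (subst card_Diff_subset) auto
    finally show "card (?box I) = card Y ^ q * card A ^ (w - q)" using I by simp
  qed
  also have "\<dots> = (w choose q) * (card Y ^ q * card A ^ (w - q))"
    by (simp add: n_subsets)
  finally show ?thesis .
qed

text \<open>Such a tuple is recovered from its other coordinates, because \<open>f\<close> ignores
  coordinate \<open>i\<close>.\<close>

lemma card_determined_coordinate_le:
  fixes A :: "'a set"
  assumes "finite A" "i < w"
    and "\<And>u u'. (\<And>j. \<lbrakk>j < w; j \<noteq> i\<rbrakk> \<Longrightarrow> u j = u' j) \<Longrightarrow> f u = f u'"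
  shows "card {u \<in> {..<w} \<rightarrow>\<^sub>E A. u i = f u} \<le> card A ^ (w - 1)"
proof -
  let ?S = "{u \<in> {..<w} \<rightarrow>\<^sub>E A. u i = f u}" and ?J = "{..<w} - {i}"
  have "inj_on (\<lambda>u. restrict u ?J) ?S"
  proof (rule inj_onI)
    fix u u' assume u: "u \<in> ?S" "u' \<in> ?S" "restrict u ?J = restrict u' ?J"
    have eq: "u j = u' j" if "j < w" "j \<noteq> i" for j
      using fun_cong[OF u(3), of j] that by simp
    then have "u i = u' i" using u assms(3)[of u u'] by auto
    with eq have coord: "u j = u' j" if "j < w" for j using that by (cases "j = i") auto
    have "u \<in> {..<w} \<rightarrow>\<^sub>E A" "u' \<in> {..<w} \<rightarrow>\<^sub>E A" using u by simp_all
    then show "u = u'" by (rule PiE_ext) (simp add: coord)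
  qed
  moreover have "(\<lambda>u. restrict u ?J) ` ?S \<subseteq> ?J \<rightarrow>\<^sub>E A"
  proof (rule image_subsetI)
    fix u assume "u \<in> ?S"
    then have "u \<in> {..<w} \<rightarrow>\<^sub>E A" by simp
    then show "restrict u ?J \<in> ?J \<rightarrow>\<^sub>E A" by (simp add: PiE_iff)
  qed
  moreover have "finite (?J \<rightarrow>\<^sub>E A)" using assms(1) by (intro finite_PiE) simp_all
  ultimately have "card ?S \<le> card (?J \<rightarrow>\<^sub>E A)" by (rule card_inj_on_le)
  also have "\<dots> = card A ^ (w - 1)"
    using assms(2) by (subst card_PiE) auto
  finally show ?thesis .
qed

text \<open>
  In the application a family \<open>\<Y>\<close> has \<open>O(r\<^sup>6)\<close> members, and each member excludes \<open>O(r\<^sup>1\<^sup>4\<^sup>-\<^sup>7)\<close> of the at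
  least \<open>r\<^sup>1\<^sup>4\<close> tuples; hence the threshold 7.
\<close>

definition (in group) generic_tuple :: "'a set \<Rightarrow> 'a set set \<Rightarrow> (nat \<Rightarrow> 'a) \<Rightarrow> bool"
  where "generic_tuple V \<Y> u \<longleftrightarrow>
    (\<forall>i<14. \<forall>j<14. i \<noteq> j \<longrightarrow> (\<forall>v\<in>V. u i \<noteq> v \<otimes> u j)) \<and>
    (\<forall>i<14. \<forall>j<14. \<forall>k<14. \<forall>l<14. i \<noteq> j \<and> i \<noteq> k \<and> i \<noteq> l \<longrightarrow> u i \<noteq> u j \<otimes> inv (u k) \<otimes> u l) \<and>
    (\<forall>Y\<in>\<Y>. card {i \<in> {..<14}. u i \<in> Y} < 7)"

text \<open>The first clause keeps the points of one code apart under \<open>V\<close>, the second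
  stops a code from matching many entries of its own translate, and the third limits the matches
  with earlier stages and with the codes of other markers.\<close>

lemma (in group)
  assumes "generic_tuple V \<Y> u"
  shows generic_tuple_separated: "\<lbrakk>i < 14; j < 14; i \<noteq> j; v \<in> V\<rbrakk> \<Longrightarrow> u i \<noteq> v \<otimes> u j"
    and generic_tuple_quotients: "\<lbrakk>i < 14; j < 14; k < 14; l < 14; i \<noteq> j; i \<noteq> k; i \<noteq> l\<rbrakk> \<Longrightarrow>
      u i \<noteq> u j \<otimes> inv (u k) \<otimes> u l"
    and generic_tuple_hits: "Y \<in> \<Y> \<Longrightarrow> card {i \<in> {..<14}. u i \<in> Y} < 7"
  using assms unfolding generic_tuple_def by simp_all

text \<open>Union bound over the bad tuples: since \<open>card A \<le> p * r\<close>, each clause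
  fails for \<open>O(r ^ 13)\<close> tuples over \<open>A\<close>, the constants being the three
  summands of the last hypothesis, whereas there are at least \<open>r ^ 14\<close> tuples over
  \<open>Av\<close>.\<close>

lemma (in group) generic_tuple_exists:
  assumes A: "finite A" "card A \<le> p * r" and Av: "Av \<subseteq> A" "r \<le> card Av"
    and V: "finite V" and \<Y>: "finite \<Y>" "card \<Y> \<le> b * r ^ 6"
    and Y: "\<And>Y. Y \<in> \<Y> \<Longrightarrow> finite Y \<and> card Y \<le> 14"
    and r: "196 * card V * p ^ 13 + 38416 * p ^ 13 + b * ((14 choose 7) * (14 ^ 7 * p ^ 7)) < r"
  shows "\<exists>u \<in> {..<14} \<rightarrow>\<^sub>E Av. generic_tuple V \<Y> u"
proof (rule ccontr)
  assume no: "\<not> (\<exists>u \<in> {..<14} \<rightarrow>\<^sub>E Av. generic_tuple V \<Y> u)"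
  let ?U = "{..<14::nat} \<rightarrow>\<^sub>E A" and ?n = "{..<14::nat}"
  let ?I1 = "{(i, j, v). i < (14::nat) \<and> j < (14::nat) \<and> i \<noteq> j \<and> v \<in> V}"
  let ?I2 = "{(i, j, k, l). i < (14::nat) \<and> j < (14::nat) \<and> k < (14::nat) \<and> l < (14::nat) \<and>
      i \<noteq> j \<and> i \<noteq> k \<and> i \<noteq> l}"
  let ?B1 = "\<lambda>(i, j, v). {u \<in> ?U. u i = v \<otimes> u j}"
  let ?B2 = "\<lambda>(i, j, k, l). {u \<in> ?U. u i = u j \<otimes> inv (u k) \<otimes> u l}"
  let ?B3 = "\<lambda>Y. {u \<in> ?U. 7 \<le> card {i \<in> {..<14}. u i \<in> Y}}"
  let ?K = "card A"
  have I1: "?I1 \<subseteq> ?n \<times> ?n \<times> V" and I2: "?I2 \<subseteq> ?n \<times> ?n \<times> ?n \<times> ?n" by auto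
  have fin: "finite ?I1" "finite ?I2"
    using finite_subset[OF I1] finite_subset[OF I2] V by auto
  \<comment> \<open>\<open>196 = 14 ^ 2\<close> and \<open>38416 = 14 ^ 4\<close> bound the choices
    of indices.\<close>
  have cI1: "card ?I1 \<le> 196 * card V"
    using card_mono[OF _ I1] V by (simp add: card_cartesian_product)
  have cI2: "card ?I2 \<le> 38416"
    using card_mono[OF _ I2] by (simp add: card_cartesian_product)
  have sub: "{..<14} \<rightarrow>\<^sub>E Av \<subseteq> (\<Union>t\<in>?I1. ?B1 t) \<union> (\<Union>t\<in>?I2. ?B2 t) \<union> (\<Union>Y\<in>\<Y>. ?B3 Y)"
  proof
    fix u assume u: "u \<in> {..<14::nat} \<rightarrow>\<^sub>E Av"
    then have uU: "u \<in> ?U" using Av by (auto simp: PiE_iff)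
    from u no have "\<not> generic_tuple V \<Y> u" by blast
    then consider i j v where "(i, j, v) \<in> ?I1" "u i = v \<otimes> u j"
      | i j k l where "(i, j, k, l) \<in> ?I2" "u i = u j \<otimes> inv (u k) \<otimes> u l"
      | Y where "Y \<in> \<Y>" "7 \<le> card {i \<in> {..<14}. u i \<in> Y}"
      unfolding generic_tuple_def by (auto simp: not_less)
    then show "u \<in> (\<Union>t\<in>?I1. ?B1 t) \<union> (\<Union>t\<in>?I2. ?B2 t) \<union> (\<Union>Y\<in>\<Y>. ?B3 Y)"
    proof cases
      case 1
      then show ?thesis using uU by (intro UnI1 UN_I[of "(i, j, v)"]) auto
    next
      case 2
      then show ?thesis using uU by (intro UnI1[OF UnI2] UN_I[of "(i, j, k, l)"]) auto
    next
      case 3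
      then show ?thesis using uU by auto
    qed
  qed
  have finU: "finite ?U" using A by (auto intro: finite_PiE)
  have c1: "card (\<Union>t\<in>?I1. ?B1 t) \<le> 196 * card V * ?K ^ 13"
  proof -
    have "card (\<Union>t\<in>?I1. ?B1 t) \<le> (\<Sum>t\<in>?I1. card (?B1 t))" by (rule card_UN_le[OF fin(1)])
    also have "\<dots> \<le> (\<Sum>t\<in>?I1. ?K ^ 13)"
    proof (rule sum_mono)
      fix t assume "t \<in> ?I1"
      then obtain i j v where t: "t = (i, j, v)" "i < 14" "j < 14" "i \<noteq> j" by auto
      have "card {u \<in> ?U. u i = v \<otimes> u j} \<le> ?K ^ (14 - 1)"
        by (rule card_determined_coordinate_le[OF A(1) t(2)]) (use t in auto)
      then show "card (?B1 t) \<le> ?K ^ 13" using t by simp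
    qed
    also have "\<dots> \<le> 196 * card V * ?K ^ 13" using cI1 by simp
    finally show ?thesis .
  qed
  have c2: "card (\<Union>t\<in>?I2. ?B2 t) \<le> 38416 * ?K ^ 13"
  proof -
    have "card (\<Union>t\<in>?I2. ?B2 t) \<le> (\<Sum>t\<in>?I2. card (?B2 t))" by (rule card_UN_le[OF fin(2)])
    also have "\<dots> \<le> (\<Sum>t\<in>?I2. ?K ^ 13)"
    proof (rule sum_mono)
      fix t assume "t \<in> ?I2"
      then obtain i j k l where t: "t = (i, j, k, l)" "i < 14" "j < 14" "k < 14" "l < 14"
        "i \<noteq> j" "i \<noteq> k" "i \<noteq> l" by auto
      have "card {u \<in> ?U. u i = u j \<otimes> inv (u k) \<otimes> u l} \<le> ?K ^ (14 - 1)"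
      proof (rule card_determined_coordinate_le[OF A(1) t(2)])
        fix u u' :: "nat \<Rightarrow> 'a" assume "\<And>j. \<lbrakk>j < 14; j \<noteq> i\<rbrakk> \<Longrightarrow> u j = u' j"
        from this[of j] this[of k] this[of l] t
        show "u j \<otimes> inv (u k) \<otimes> u l = u' j \<otimes> inv (u' k) \<otimes> u' l" by simp
      qed
      then show "card (?B2 t) \<le> ?K ^ 13" using t by simp
    qed
    also have "\<dots> \<le> 38416 * ?K ^ 13" using cI2 by simp
    finally show ?thesis .
  qed
  have c3: "card (\<Union>Y\<in>\<Y>. ?B3 Y) \<le> b * r ^ 6 * ((14 choose 7) * (14 ^ 7 * ?K ^ 7))"
  proof -
    have "card (\<Union>Y\<in>\<Y>. ?B3 Y) \<le> (\<Sum>Y\<in>\<Y>. card (?B3 Y))" by (rule card_UN_le[OF \<Y>(1)])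
    also have "\<dots> \<le> (\<Sum>Y\<in>\<Y>. (14 choose 7) * (14 ^ 7 * ?K ^ 7))"
    proof (rule sum_mono)
      fix Z assume Z: "Z \<in> \<Y>"
      have "card (?B3 Z) \<le> (14 choose 7) * (card Z ^ 7 * ?K ^ (14 - 7))"
        using Y[OF Z] by (intro card_many_hits_le[OF A(1)]) auto
      also have "\<dots> \<le> (14 choose 7) * (14 ^ 7 * ?K ^ 7)"
        using Y[OF Z] by (intro mult_le_mono power_mono) auto
      finally show "card (?B3 Z) \<le> (14 choose 7) * (14 ^ 7 * ?K ^ 7)" .
    qed
    also have "\<dots> = card \<Y> * ((14 choose 7) * (14 ^ 7 * ?K ^ 7))" by simp
    also have "\<dots> \<le> b * r ^ 6 * ((14 choose 7) * (14 ^ 7 * ?K ^ 7))"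
      using \<Y>(2) by (rule mult_le_mono1)
    finally show ?thesis .
  qed
  have K: "?K ^ n \<le> p ^ n * r ^ n" for n
    using power_mono[OF A(2), of n] by (simp add: power_mult_distrib)
  have "finite Av" using A Av by (auto intro: finite_subset)
  then have "r ^ 14 \<le> card ({..<14::nat} \<rightarrow>\<^sub>E Av)"
    using power_mono[OF Av(2), of 14] by (simp add: card_PiE)
  also have "\<dots> \<le> card ((\<Union>t\<in>?I1. ?B1 t) \<union> (\<Union>t\<in>?I2. ?B2 t) \<union> (\<Union>Y\<in>\<Y>. ?B3 Y))"
    by (rule card_mono[OF finite_subset[OF _ finU] sub]) auto
  also have "\<dots> \<le> card (\<Union>t\<in>?I1. ?B1 t) + card (\<Union>t\<in>?I2. ?B2 t) + card (\<Union>Y\<in>\<Y>. ?B3 Y)"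
    by (intro order_trans[OF card_Un_le] add_mono card_Un_le order_refl)
  also have "\<dots> \<le> 196 * card V * ?K ^ 13 + 38416 * ?K ^ 13
      + b * r ^ 6 * ((14 choose 7) * (14 ^ 7 * ?K ^ 7))"
    by (intro add_mono c1 c2 c3)
  also have "\<dots> \<le> 196 * card V * (p ^ 13 * r ^ 13) + 38416 * (p ^ 13 * r ^ 13)
      + b * r ^ 6 * ((14 choose 7) * (14 ^ 7 * (p ^ 7 * r ^ 7)))"
    by (intro add_mono mult_le_mono K order_refl)
  also have "\<dots> = (196 * card V * p ^ 13 + 38416 * p ^ 13 + b * ((14 choose 7) * (14 ^ 7 * p ^ 7))) * r ^ 13"
  proof -
    have "r ^ 13 = r ^ 6 * r ^ 7" by (simp flip: power_add)
    then show ?thesis by (simp only: distrib_right distrib_left mult.assoc mult.left_commute mult.commute)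
  qed
  also have "\<dots> < r * r ^ 13"
    using r by (intro mult_strict_right_mono) auto
  also have "\<dots> = r ^ 14" by (simp flip: power_Suc)
  finally show False by simp
qed

section \<open>The inductive step\<close>

context free_borel_action
begin

text \<open>Each step adds a translate \<open>P q\<close> disjoint from \<open>A\<close>, which
  exists because \<open>G\<close> is infinite. Some \<open>p \<in> P\<close> moves
  \<open>q x\<close> out of \<open>Z\<close>, so every \<open>x\<close> gains a point. Thus at least
  the proportion \<open>1 / card P\<close> of \<open>A\<close> is available at every point.\<close>

lemma many_translates_outside:
  assumes P: "finite P" "P \<subseteq> carrier G" and synd: "\<And>x. x \<in> space X \<Longrightarrow> \<exists>p\<in>P. \<phi> p x \<notin> Z"
  shows "\<exists>A. finite A \<and> A \<subseteq> carrier G \<and> card A \<le> card P * r \<and>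
    (\<forall>x\<in>space X. r \<le> card {a \<in> A. \<phi> a x \<notin> Z})"
proof (induction r)
  case 0
  show ?case by (intro exI[of _ "{}"]) auto
next
  case (Suc r)
  then obtain A where A: "finite A" "A \<subseteq> carrier G" "card A \<le> card P * r"
    and r: "\<And>x. x \<in> space X \<Longrightarrow> r \<le> card {a \<in> A. \<phi> a x \<notin> Z}" by auto
  have "finite ((\<lambda>(p, a). inv p \<otimes> a) ` (P \<times> A))" using A P by auto
  then obtain q where q: "q \<in> carrier G" "q \<notin> (\<lambda>(p, a). inv p \<otimes> a) ` (P \<times> A)"
    using infinite_carrier by (meson finite_subset subsetI)
  let ?B = "(\<lambda>p. p \<otimes> q) ` P"
  have disj: "p \<otimes> q \<notin> A" if "p \<in> P" for p
  proof
    assume "p \<otimes> q \<in> A"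
    moreover have "q = inv p \<otimes> (p \<otimes> q)" using that P q by (simp flip: m_assoc add: subset_iff)
    ultimately have "q \<in> (\<lambda>(p, a). inv p \<otimes> a) ` (P \<times> A)"
      using that by (intro image_eqI[of _ _ "(p, p \<otimes> q)"]) auto
    then show False using q(2) by blast
  qed
  show ?case
  proof (intro exI[of _ "A \<union> ?B"] conjI ballI)
    show "finite (A \<union> ?B)" "A \<union> ?B \<subseteq> carrier G" using A P q by auto
    show "card (A \<union> ?B) \<le> card P * Suc r"
      using card_Un_le[of A ?B] card_image_le[OF P(1), of "\<lambda>p. p \<otimes> q"] A(3) by simp
    fix x assume x: "x \<in> space X"
    obtain p where p: "p \<in> P" "\<phi> p (\<phi> q x) \<notin> Z" using synd[of "\<phi> q x"] x q act_closed by auto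
    then have "insert (p \<otimes> q) {a \<in> A. \<phi> a x \<notin> Z} \<subseteq> {a \<in> A \<union> ?B. \<phi> a x \<notin> Z}"
      using x q P by (auto simp: act_mult subset_iff)
    then have "card (insert (p \<otimes> q) {a \<in> A. \<phi> a x \<notin> Z}) \<le> card {a \<in> A \<union> ?B. \<phi> a x \<notin> Z}"
      using A P by (intro card_mono) auto
    then show "Suc r \<le> card {a \<in> A \<union> ?B. \<phi> a x \<notin> Z}"
      using disj[OF p(1)] r[OF x] A(1) by simp
  qed
qed

text \<open>Codes are picked by recursion along \<open>\<kappa>\<close>. A pair
  \<open>(\<rho>, \<tau>)\<close> in \<open>J\<close> names a neighbour \<open>\<rho> x\<close> and
  the right multiplication by \<open>\<tau>\<close> that makes its code comparable with that of
  \<open>x\<close>. The neighbours of smaller colour, together with \<open>W x\<close>, yield few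
  enough sets for a generic tuple to exist.\<close>

lemma borel_generic_tuples:
  fixes W :: "'x \<Rightarrow> 'g set set" and \<kappa> :: "'x \<Rightarrow> nat"
  assumes A: "finite A" "A \<subseteq> carrier G" "card A \<le> p * r" and V: "finite V"
    and Z: "Z \<in> sets X" and avail: "\<And>x. x \<in> space X \<Longrightarrow> r \<le> card {a \<in> A. \<phi> a x \<notin> Z}"
    and J: "finite J" "fst ` J \<subseteq> carrier G"
    and W: "countable_borel_fun X W"
    and W_fin: "\<And>x. x \<in> space X \<Longrightarrow> finite (W x) \<and> card (W x) + card J \<le> b * r ^ 6"
    and W_card: "\<And>x Y. \<lbrakk>x \<in> space X; Y \<in> W x\<rbrakk> \<Longrightarrow> finite Y \<and> card Y \<le> 14"
    and r: "196 * card V * p ^ 13 + 38416 * p ^ 13 + b * ((14 choose 7) * (14 ^ 7 * p ^ 7)) < r"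
    and \<kappa>: "countable_borel_fun X \<kappa>"
  obtains T where "countable_borel_fun X T"
    and "\<And>x. x \<in> space X \<Longrightarrow> T x \<in> {..<14} \<rightarrow>\<^sub>E {a \<in> A. \<phi> a x \<notin> Z}"
    and "\<And>x. x \<in> space X \<Longrightarrow> generic_tuple V
      (W x \<union> {(\<lambda>i. T (\<phi> \<rho> x) i \<otimes> \<tau>) ` {..<14} |\<rho> \<tau>. (\<rho>, \<tau>) \<in> J \<and> \<kappa> (\<phi> \<rho> x) < \<kappa> x}) (T x)"
proof -
  define nbrs where "nbrs q = {(\<lambda>i. t i \<otimes> \<tau>) ` {..<14::nat} |\<rho> \<tau> t. (\<rho>, \<tau>) \<in> J \<and> q \<rho> = Some t}"
    for q :: "'g \<Rightarrow> (nat \<Rightarrow> 'g) option"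
  define good where "good = (\<lambda>(w, av) q u. u \<in> {..<14} \<rightarrow>\<^sub>E av \<and> generic_tuple V (w \<union> nbrs q) u)"
  \<comment> \<open>The choice by \<open>SOME\<close> depends on \<open>x\<close> only through
    \<open>W x\<close>, the available elements and the earlier codes, so it is a legitimate step of
    the Borel recursion.\<close>
  define step where "step d q = (SOME u. good d q u)" for d q
  define \<delta> where "\<delta> x = (W x, {a \<in> A. \<phi> a x \<notin> Z})" for x
  have "countable_borel_fun X (\<lambda>x. \<phi> a x \<notin> Z)" if "a \<in> A" for a
    using countable_borel_fun_comp[OF countable_borel_fun_translate[OF countable_borel_fun_mem[OF Z]], where h = Not] that A by auto
  from countable_borel_fun_Pair[OF W countable_borel_fun_subset[OF A(1) this]] have \<delta>: "countable_borel_fun X \<delta>"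
    unfolding \<delta>_def[abs_def] .
  have fJ: "finite (fst ` J)" using J by simp
  obtain T where T: "countable_borel_fun X T" and T_rec: "\<And>x. x \<in> space X \<Longrightarrow> T x = step (\<delta> x)
      (\<lambda>g. if g \<in> fst ` J then if \<kappa> (\<phi> g x) < \<kappa> x then Some (T (\<phi> g x)) else None else None)"
    using borel_recursion[OF \<kappa> \<delta> fJ J(2), of step] by blast
  have T_good: "T x \<in> {..<14} \<rightarrow>\<^sub>E {a \<in> A. \<phi> a x \<notin> Z} \<and> generic_tuple V
      (W x \<union> {(\<lambda>i. T (\<phi> \<rho> x) i \<otimes> \<tau>) ` {..<14} |\<rho> \<tau>. (\<rho>, \<tau>) \<in> J \<and> \<kappa> (\<phi> \<rho> x) < \<kappa> x}) (T x)"
    if x: "x \<in> space X" for x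
  proof -
    define q where "q g = (if g \<in> fst ` J then if \<kappa> (\<phi> g x) < \<kappa> x then Some (T (\<phi> g x)) else None else None)" for g
    have nbrs_eq: "nbrs q = {(\<lambda>i. T (\<phi> \<rho> x) i \<otimes> \<tau>) ` {..<14} |\<rho> \<tau>. (\<rho>, \<tau>) \<in> J \<and> \<kappa> (\<phi> \<rho> x) < \<kappa> x}"
      unfolding nbrs_def q_def by (force split: if_splits)
    have sub: "nbrs q \<subseteq> (\<lambda>(\<rho>, \<tau>). (\<lambda>i. the (q \<rho>) i \<otimes> \<tau>) ` {..<14}) ` J"
      unfolding nbrs_def by force
    have nbrs_fin: "finite (nbrs q)" "card (nbrs q) \<le> card J"
      using finite_subset[OF sub] card_mono[OF _ sub] card_image_le[OF J(1)] J(1)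
      by (auto intro: order_trans)
    have "\<exists>u \<in> {..<14} \<rightarrow>\<^sub>E {a \<in> A. \<phi> a x \<notin> Z}. generic_tuple V (W x \<union> nbrs q) u"
    proof (rule generic_tuple_exists[OF A(1,3) _ avail[OF x] V _ _ _ r])
      show "finite (W x \<union> nbrs q)" using W_fin[OF x] nbrs_fin by simp
      show "card (W x \<union> nbrs q) \<le> b * r ^ 6"
        using card_Un_le[of "W x" "nbrs q"] W_fin[OF x] nbrs_fin(2) by linarith
      fix Y assume "Y \<in> W x \<union> nbrs q"
      then show "finite Y \<and> card Y \<le> 14"
      proof
        assume "Y \<in> nbrs q"
        then obtain \<tau> t where "Y = (\<lambda>i. t i \<otimes> \<tau>) ` {..<14::nat}" unfolding nbrs_def by blast
        then show ?thesis using card_image_le[of "{..<14::nat}" "\<lambda>i. t i \<otimes> \<tau>"] by simp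
      qed (use W_card[OF x] in simp)
    qed auto
    then have "\<exists>u. good (\<delta> x) q u" unfolding good_def \<delta>_def by auto
    then have "good (\<delta> x) q (step (\<delta> x) q)" unfolding step_def by (rule someI_ex)
    moreover have "step (\<delta> x) q = T x" using T_rec[OF x] unfolding q_def[abs_def] by simp
    ultimately show ?thesis unfolding good_def \<delta>_def by (simp add: nbrs_eq)
  qed
  show ?thesis by (rule that[OF T]) (use T_good in blast)+
qed

text \<open>If \<open>u i \<otimes> c = u (s i)\<close> and
  \<open>u k \<otimes> c = u (s k)\<close>, cancelling \<open>c\<close> gives
  \<open>u k = u (s k) \<otimes> inv (u (s i)) \<otimes> u i\<close>. Genericity excludes this as
  soon as one of the indices differs from the other three. Three indices in \<open>I\<close> suffice
  to find \<open>k\<close> different from both \<open>i\<close> and \<open>s i\<close>.\<close>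

lemma generic_tuple_no_shift:
  assumes gen: "generic_tuple V \<Y> u" and u: "\<And>i. i < 14 \<Longrightarrow> u i \<in> carrier G"
    and c: "c \<in> carrier G" "c \<noteq> \<one>"
    and I: "I \<subseteq> {..<14}" "3 \<le> card I" and shift: "\<And>i. i \<in> I \<Longrightarrow> \<exists>j<14. u i \<otimes> c = u j"
  shows False
proof -
  obtain s where s: "\<And>i. i \<in> I \<Longrightarrow> s i < 14 \<and> u i \<otimes> c = u (s i)" using shift by metis
  have s_neq: "s i \<noteq> i" if "i \<in> I" for i
  proof
    assume "s i = i"
    then have "u i \<otimes> c = u i" using s[OF that] by simp
    then show False using c u[of i] that I by auto
  qed
  note gen = generic_tuple_quotients[OF gen]
  have eq: "u k = u (s k) \<otimes> inv (u (s i)) \<otimes> u i" if "i \<in> I" "k \<in> I" for i k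
  proof -
    have "u i \<in> carrier G" "u k \<in> carrier G" using u that I by auto
    moreover have "u (s k) = u k \<otimes> c" "u (s i) = u i \<otimes> c" using s that by auto
    ultimately show ?thesis using c by (simp add: inv_mult_group m_assoc)
  qed
  obtain I' where "I' \<subseteq> I" "card I' = 3" using obtain_subset_with_card_n[OF I(2)] by metis
  then obtain i k\<^sub>1 k\<^sub>2 where ik: "i \<in> I" "k\<^sub>1 \<in> I" "k\<^sub>2 \<in> I" "i \<noteq> k\<^sub>1" "i \<noteq> k\<^sub>2" "k\<^sub>1 \<noteq> k\<^sub>2"
    by (auto simp: card_3_iff)
  then obtain k where k: "k \<in> I" "k \<noteq> i" "k \<noteq> s i" by metis
  have lt: "i < 14" "k < 14" "s i < 14" "s k < 14" using ik k s I by auto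
  show False
  proof (cases "s k = i")
    case True
    then show False
      using gen[of k i "s i" i] eq[OF ik(1) k(1)] lt k by auto
  next
    case False
    then show False
      using gen[of i "s i" "s k" k] eq[OF k(1) ik(1)] lt k s_neq[OF ik(1)] by auto
  qed
qed

text \<open>
  One stage: \<open>E\<close> is the part of \<open>M\<close> built so far, \<open>N\<close> the part added, \<open>L\<close> stands for all that later
  stages add, and \<open>V\<close> collects the translations by which points of \<open>N\<close> must be kept apart. In the
  comparison of a code with the pattern at \<open>c m\<close>, at most 6 of the 14 entries are matched by \<open>E\<close> and at
  most 1 by \<open>L\<close>, so at least 7 are matched by the code of one marker.
\<close>

lemma extension:
  assumes E: "E \<in> sets X" and Z: "Z \<in> sets X" and OZ: "E \<subseteq> Z"
    and P: "finite P" "P \<subseteq> carrier G" and synd: "\<And>x. x \<in> space X \<Longrightarrow> \<exists>p\<in>P. \<phi> p x \<notin> Z"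
    and V: "finite V" "V \<subseteq> carrier G" "\<one> \<in> V"
    and \<gamma>: "\<gamma> \<in> carrier G" "\<gamma> \<noteq> \<one>" and ne: "space X \<noteq> {}"
  obtains N Z' P' Q where "N \<in> sets X" "Z' \<in> sets X" "N \<inter> Z = {}" "Z \<subseteq> Z'"
    and "\<And>z v. \<lbrakk>z \<in> N; v \<in> V\<rbrakk> \<Longrightarrow> \<phi> v z \<in> Z'"
    and "\<And>z v. \<lbrakk>z \<in> N; v \<in> V; \<phi> v z \<in> N\<rbrakk> \<Longrightarrow> v = \<one>"
    and "finite P'" "P' \<subseteq> carrier G" "\<And>x. x \<in> space X \<Longrightarrow> \<exists>p\<in>P'. \<phi> p x \<notin> Z'"
    and "finite Q" "Q \<subseteq> carrier G" "\<And>q. q \<in> Q \<Longrightarrow> inv q \<in> Q"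
    and "\<And>L x. \<lbrakk>L \<subseteq> space X; L \<inter> Z' = {}; \<And>z q. \<lbrakk>z \<in> L; q \<in> Q; \<phi> q z \<in> L\<rbrakk> \<Longrightarrow> q = \<one>; x \<in> space X\<rbrakk>
      \<Longrightarrow> \<exists>h\<in>carrier G. (\<phi> h x \<in> E \<union> N \<union> L) \<noteq> (\<phi> h (\<phi> \<gamma> x) \<in> E \<union> N \<union> L)"
proof -

  \<comment> \<open>Constants, room for the codes, and forbidden differences of markers\<close>
  define p v where "p = card P" and "v = card V"
  \<comment> \<open>With \<open>K = card A\<close>, the set \<open>D\<close> below has at most
    \<open>\<beta> * K ^ 4\<close> elements, and the sets that a code must avoid number at most
    \<open>9 * \<beta> * K ^ 6 \<le> b * r ^ 6\<close>, as \<open>K \<le> p * r\<close>. Neither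
    \<open>\<beta>\<close> nor \<open>b\<close> involves \<open>r\<close>, so \<open>r\<close> can
    be chosen after them.\<close>
  define \<beta> where "\<beta> = 1 + v + v\<^sup>2 * p\<^sup>2"
  define b where "b = 9 * \<beta> * p ^ 6"
  define r where "r = Suc (196 * v * p ^ 13 + 38416 * p ^ 13 + b * ((14 choose 7) * (14 ^ 7 * p ^ 7)))"
  obtain A where A: "finite A" "A \<subseteq> carrier G" "card A \<le> p * r"
    and avail: "\<And>x. x \<in> space X \<Longrightarrow> r \<le> card {a \<in> A. \<phi> a x \<notin> Z}"
    using many_translates_outside[OF P synd, of r] unfolding p_def by blast
  \<comment> \<open>\<open>F m\<close> contains all \<open>V\<close>-translates of the points that
    the code of a marker \<open>m\<close> can use; it is what \<open>m\<close> settles in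
    \<open>Z'\<close>.\<close>
  define F where "F = (\<lambda>(v, a). v \<otimes> a) ` (V \<times> A)"
  have F: "finite F" "F \<subseteq> carrier G" using A V unfolding F_def by auto
  have AF: "A \<subseteq> F"
  proof
    fix a assume "a \<in> A"
    then show "a \<in> F" unfolding F_def using A V by (intro image_eqI[of _ _ "(\<one>, a)"]) auto
  qed
  have [simp]: "a \<in> A \<Longrightarrow> a \<in> carrier G" "a \<in> F \<Longrightarrow> a \<in> carrier G" "a \<in> P \<Longrightarrow> a \<in> carrier G"
    "a \<in> V \<Longrightarrow> a \<in> carrier G" for a using A F P V by auto
  \<comment> \<open>This \<open>g\<close> keeps the complement of \<open>Z'\<close> syndetic: if
    \<open>p x\<close> and \<open>q g x\<close> lie outside \<open>Z\<close> but both in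
    \<open>F S\<close>, the third part of \<open>D\<close> makes their markers coincide, and then
    \<open>g\<close> is one of the products excluded here.\<close>
  have "finite ((\<lambda>(q, f, f', p). inv q \<otimes> f \<otimes> inv f' \<otimes> p) ` (P \<times> F \<times> F \<times> P))" using F P by auto
  then obtain g where g: "g \<in> carrier G"
    and g_notin: "g \<notin> (\<lambda>(q, f, f', p). inv q \<otimes> f \<otimes> inv f' \<otimes> p) ` (P \<times> F \<times> F \<times> P)"
    using infinite_carrier by (meson finite_subset subsetI)
  \<comment> \<open>Distinct markers must not differ by a product from
    \<open>A\<inverse> A A\<inverse> A\<close>, so that a translate \<open>A y\<close> meets
    \<open>A m\<close> for one marker only; nor from \<open>A\<inverse> V A\<close>, so that
    different codes stay \<open>V\<close>-apart; nor by a product through \<open>g\<close>, for the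
    syndeticity of the complement of \<open>Z'\<close>.\<close>
  define D where "D = (\<lambda>(a, b, c, d). inv a \<otimes> b \<otimes> inv c \<otimes> d) ` (A \<times> A \<times> A \<times> A)
    \<union> (\<lambda>(a, v, b). inv a \<otimes> v \<otimes> b) ` (A \<times> V \<times> A)
    \<union> (\<lambda>(f, q, p, f'). inv f \<otimes> q \<otimes> g \<otimes> inv p \<otimes> f') ` (F \<times> P \<times> P \<times> F)"
  have D: "finite D" "D \<subseteq> carrier G" using A F P V g unfolding D_def by auto
  have D1: "inv a \<otimes> b \<otimes> inv c \<otimes> d \<in> D" if "a \<in> A" "b \<in> A" "c \<in> A" "d \<in> A" for a b c d
    unfolding D_def using that by (intro UnI1 image_eqI[of _ _ "(a, b, c, d)"]) auto
  have D2: "inv a \<otimes> v \<otimes> b \<in> D" if "a \<in> A" "v \<in> V" "b \<in> A" for a b v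
    unfolding D_def using that by (intro UnI1[OF UnI2] image_eqI[of _ _ "(a, v, b)"]) auto
  have D3: "inv f \<otimes> q \<otimes> g \<otimes> inv p \<otimes> f' \<in> D" if "f \<in> F" "q \<in> P" "p \<in> P" "f' \<in> F" for f f' p q
    unfolding D_def using that by (intro UnI2 image_eqI[of _ _ "(f, q, p, f')"]) auto

  \<comment> \<open>Markers, comparison elements and possible conflicts between codes\<close>
  obtain S where S: "S \<in> sets X"
    and S_discrete: "\<And>s d. \<lbrakk>s \<in> S; d \<in> D; \<phi> d s \<in> S\<rbrakk> \<Longrightarrow> d = \<one>"
    and S_maximal: "\<And>x. x \<in> space X \<Longrightarrow> \<exists>d \<in> insert \<one> (D \<union> m_inv G ` D). \<phi> d x \<in> S"
    using maximal_discrete[OF D] by metis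
  have S_space [simp]: "s \<in> S \<Longrightarrow> s \<in> space X" for s using sets.sets_into_space[OF S] by auto
  define B where "B = insert \<one> (D \<union> m_inv G ` D)"
  \<comment> \<open>If \<open>m = d x\<close> then \<open>d \<gamma> x = c m\<close> for the
    conjugate \<open>c = d \<gamma> d\<inverse>\<close>.\<close>
  define C where "C = (\<lambda>d. d \<otimes> \<gamma> \<otimes> inv d) ` B"
  have B: "finite B" "B \<subseteq> carrier G" using D unfolding B_def by auto
  have C: "finite C" "C \<subseteq> carrier G" using B \<gamma> unfolding C_def by auto
  have [simp]: "d \<in> D \<Longrightarrow> d \<in> carrier G" "d \<in> B \<Longrightarrow> d \<in> carrier G" "d \<in> C \<Longrightarrow> d \<in> carrier G" for d
    using B C D by auto
  \<comment> \<open>If \<open>a c m = a' m'\<close> for code entries \<open>a\<close> of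
    \<open>m\<close> and \<open>a'\<close> of \<open>m'\<close>, then \<open>m' = \<sigma> m\<close>
    with \<open>\<sigma> = a'\<inverse> a c\<close>. Matching entries satisfy
    \<open>T m i \<otimes> c = T m' j \<otimes> \<sigma>\<close>. The first half of \<open>J\<close>
    solves this for \<open>T m i\<close>, the second for \<open>T m' j\<close>, since either marker
    may have the larger colour.\<close>
  define J where "J = (\<lambda>(a', a, c). (inv a' \<otimes> a \<otimes> c, inv a' \<otimes> a \<otimes> c \<otimes> inv c)) ` (A \<times> A \<times> C)
    \<union> (\<lambda>(a', a, c). (inv (inv a' \<otimes> a \<otimes> c), c \<otimes> inv (inv a' \<otimes> a \<otimes> c))) ` (A \<times> A \<times> C)"
  have J: "finite J" "fst ` J \<subseteq> carrier G" using A C unfolding J_def by auto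
  have J1: "(inv a' \<otimes> a \<otimes> c, inv a' \<otimes> a \<otimes> c \<otimes> inv c) \<in> J"
    and J2: "(inv (inv a' \<otimes> a \<otimes> c), c \<otimes> inv (inv a' \<otimes> a \<otimes> c)) \<in> J"
    if "a' \<in> A" "a \<in> A" "c \<in> C" for a a' c
    unfolding J_def using that by (force intro: image_eqI[of _ _ "(a', a, c)"])+

  \<comment> \<open>Sets to be avoided by a code, and their number\<close>
  define excess where "excess x c = {a \<in> A. \<phi> (a \<otimes> c) x \<in> E \<and> \<phi> a x \<notin> E}" for x c
  \<comment> \<open>If the patterns at \<open>m\<close> and \<open>c m\<close> agree, every element
    of \<open>excess m c\<close> is an entry of the code of \<open>m\<close>. A code with fewer than
    7 entries in one 7-element subset cannot achieve this, so agreement forces an excess of at most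
    6.\<close>
  define W where "W x = (\<lambda>c. SOME Y. Y \<subseteq> excess x c \<and> card Y = 7) ` {c \<in> C. 7 \<le> card (excess x c)}" for x
  have excess_fin: "finite (excess x c)" for x c using A unfolding excess_def by auto
  have seven: "(SOME Y. Y \<subseteq> excess x c \<and> card Y = 7) \<subseteq> excess x c \<and>
      card (SOME Y. Y \<subseteq> excess x c \<and> card Y = 7) = 7" if "7 \<le> card (excess x c)" for x c
    by (rule someI_ex) (use obtain_subset_with_card_n[OF that] in metis)
  have W: "countable_borel_fun X W"
  proof -
    have "countable_borel_fun X (\<lambda>x. \<phi> h x \<in> E)" if "h \<in> carrier G" for h
      using countable_borel_fun_translate[OF countable_borel_fun_mem[OF E] that] .
    then have "countable_borel_fun X (\<lambda>x. \<phi> (a \<otimes> c) x \<in> E \<and> \<phi> a x \<notin> E)" if "a \<in> A" "c \<in> C" for a c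
      using countable_borel_fun_comp2[of X "\<lambda>x. \<phi> (a \<otimes> c) x \<in> E" "\<lambda>x. \<phi> a x \<in> E" "\<lambda>s t. s \<and> \<not> t"] that by simp
    from countable_borel_fun_subset[OF A(1) this] have "countable_borel_fun X (\<lambda>x. excess x c)" if "c \<in> C" for c
      unfolding excess_def using that by simp
    from countable_borel_fun_family[OF C(1) this, of "\<lambda>c. c" "{}"]
    have fam: "countable_borel_fun X (\<lambda>x c. if c \<in> C then excess x c else {})" by simp
    \<comment> \<open>Written in this way, \<open>W x\<close> is a function of the finitely many
      sets \<open>excess x c\<close> with \<open>c \<in> C\<close>, which form a single value with
      countable range.\<close>
    have "W x = (\<lambda>c. SOME Y. Y \<subseteq> (if c \<in> C then excess x c else {}) \<and> card Y = 7) `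
        {c \<in> C. 7 \<le> card (if c \<in> C then excess x c else {})}" for x
      unfolding W_def by (intro image_cong) auto
    with countable_borel_fun_comp[OF fam, where h = "\<lambda>e. (\<lambda>c. SOME Y. Y \<subseteq> e c \<and> card Y = 7) ` {c \<in> C. 7 \<le> card (e c)}"]
    show ?thesis by (simp add: W_def[abs_def])
  qed
  have W_card: "finite Y \<and> card Y \<le> 14" if "Y \<in> W x" for x Y
    using that seven[of x] finite_subset[OF _ excess_fin] unfolding W_def by fastforce
  have bound: "finite (W x) \<and> card (W x) + card J \<le> b * r ^ 6" for x
  proof
    show "finite (W x)" using C unfolding W_def by auto
    define K where "K = card A"
    \<comment> \<open>A point of the space gives \<open>1 \<le> r \<le> K\<close>, so that lower
      powers of \<open>K\<close> are absorbed by higher ones.\<close>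
    obtain x\<^sub>0 where "x\<^sub>0 \<in> space X" using ne by blast
    then have "r \<le> card {a \<in> A. \<phi> a x\<^sub>0 \<notin> Z}" using avail by blast
    also have "\<dots> \<le> K" unfolding K_def using A by (intro card_mono) auto
    finally have K1: "1 \<le> K" by (simp add: r_def)
    have cF: "card F \<le> v * K"
      unfolding F_def K_def v_def
      using card_image_le[of "V \<times> A" "\<lambda>(v, a). v \<otimes> a"] A V by (simp add: card_cartesian_product)
    have "card D \<le> K * (K * (K * K)) + K * (v * K) + card F * (p * (p * card F))"
      unfolding D_def K_def v_def p_def
      using A V P F by (intro order_trans[OF card_Un_le] add_mono order_trans[OF card_image_le])
        (auto simp: card_cartesian_product)
    also have "card F * (p * (p * card F)) \<le> (v * K) * (p * (p * (v * K)))"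
      using cF by (intro mult_le_mono) auto
    also have "K * (K * (K * K)) + K * (v * K) + (v * K) * (p * (p * (v * K)))
        = K ^ 4 + v * K ^ 2 + v\<^sup>2 * p\<^sup>2 * K ^ 2" by (simp add: power2_eq_square power4_eq_xxxx algebra_simps)
    also have "\<dots> \<le> K ^ 4 + v * K ^ 4 + v\<^sup>2 * p\<^sup>2 * K ^ 4"
      using power_increasing[of 2 4 K] K1 by (intro add_mono mult_le_mono) auto
    also have "\<dots> = \<beta> * K ^ 4" by (simp add: \<beta>_def algebra_simps)
    finally have cD: "card D \<le> \<beta> * K ^ 4" by simp
    have "card C \<le> card B" unfolding C_def by (rule card_image_le[OF B(1)])
    also have "\<dots> \<le> Suc (card D + card D)"
      unfolding B_def using card_Un_le[of D "m_inv G ` D"] card_image_le[OF D(1), of "m_inv G"]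
      by (intro order_trans[OF card_insert_le_m1[of "Suc (card D + card D)"]]) auto
    also have "\<dots> \<le> 3 * (\<beta> * K ^ 4)"
    proof -
      have "1 * 1 \<le> \<beta> * K ^ 4"
        using one_le_power[OF K1, of 4] by (intro mult_le_mono) (auto simp: \<beta>_def)
      then show ?thesis using cD by linarith
    qed
    finally have cC: "card C \<le> 3 * (\<beta> * K ^ 4)" .
    have "card (W x) \<le> card C"
      unfolding W_def using C by (intro order_trans[OF card_image_le card_mono]) auto
    moreover have "card J \<le> K * (K * card C) + K * (K * card C)"
      unfolding J_def K_def
      using A C by (intro order_trans[OF card_Un_le] add_mono order_trans[OF card_image_le])
        (auto simp: card_cartesian_product)
    ultimately have "card (W x) + card J \<le> card C * (1 + 2 * K ^ 2)"
      by (simp add: power2_eq_square algebra_simps)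
    also have "\<dots> \<le> (3 * (\<beta> * K ^ 4)) * (3 * K ^ 2)"
      using cC K1 by (intro mult_le_mono) auto
    also have "\<dots> = 9 * \<beta> * K ^ 6"
      by (simp add: power_add[of K 4 2, simplified] algebra_simps)
    also have "\<dots> \<le> 9 * \<beta> * (p * r) ^ 6"
      using A(3) unfolding K_def by (intro mult_le_mono power_mono) auto
    also have "\<dots> = b * r ^ 6" by (simp add: b_def power_mult_distrib)
    finally show "card (W x) + card J \<le> b * r ^ 6" .
  qed
  have r_large: "196 * card V * p ^ 13 + 38416 * p ^ 13 + b * ((14 choose 7) * (14 ^ 7 * p ^ 7)) < r"
    by (simp add: r_def v_def)

  \<comment> \<open>Choice of the codes\<close>
  obtain \<kappa> :: "'x \<Rightarrow> nat" where \<kappa>: "countable_borel_fun X \<kappa>"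
    and \<kappa>_neq: "\<And>g x. \<lbrakk>g \<in> fst ` J; g \<noteq> \<one>; x \<in> space X\<rbrakk> \<Longrightarrow> \<kappa> (\<phi> g x) \<noteq> \<kappa> x"
    using borel_colouring[OF _ J(2)] J(1) by blast
  obtain T where T: "countable_borel_fun X T"
    and T_avail: "\<And>x. x \<in> space X \<Longrightarrow> T x \<in> {..<14} \<rightarrow>\<^sub>E {a \<in> A. \<phi> a x \<notin> Z}"
    and T_gen: "\<And>x. x \<in> space X \<Longrightarrow> generic_tuple V
      (W x \<union> {(\<lambda>i. T (\<phi> \<rho> x) i \<otimes> \<tau>) ` {..<14} |\<rho> \<tau>. (\<rho>, \<tau>) \<in> J \<and> \<kappa> (\<phi> \<rho> x) < \<kappa> x}) (T x)"
    by (rule borel_generic_tuples[OF A V(1) Z avail J W bound W_card r_large \<kappa>])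
      (assumption+, rule that)
  have TA [simp]: "T x i \<in> A" and TZ: "\<phi> (T x i) x \<notin> Z" if "x \<in> space X" "i < 14" for x i
    using T_avail[OF that(1)] that(2) by (auto simp: PiE_iff)
  have T_sep: "T x i \<noteq> v \<otimes> T x j" if "x \<in> space X" "i < 14" "j < 14" "i \<noteq> j" "v \<in> V" for x i j v
    by (rule generic_tuple_separated[OF T_gen[OF that(1)] that(2-5)])
  \<comment> \<open>As \<open>\<one> \<in> V\<close>, the separation clause includes injectivity of
    the code.\<close>
  have T_inj: "i = j" if "x \<in> space X" "i < 14" "j < 14" "T x i = T x j" for x i j
  proof (rule ccontr)
    assume "i \<noteq> j"
    from T_sep[OF that(1-3) this V(3)] have "T x i \<noteq> T x j" using TA[OF that(1,3)] by simp
    then show False using that(4) by contradiction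
  qed

  \<comment> \<open>The new sets and their separation properties\<close>
  define N where "N = {z \<in> space X. \<exists>m\<in>S. \<exists>i<14. z = \<phi> (T m i) m}"
  define Z' where "Z' = Z \<union> {z \<in> space X. \<exists>f\<in>F. \<phi> (inv f) z \<in> S}"
  have FZ': "\<phi> f m \<in> Z'" if "f \<in> F" "m \<in> S" for f m
    unfolding Z'_def using that act_closed[of f m] by (auto intro!: bexI[of _ f])
  \<comment> \<open>The element carrying \<open>m\<close> to \<open>m'\<close> lies in the first
    part of \<open>D\<close>, hence is the identity.\<close>
  have base: "m' = m" if "y \<in> space X" "a \<in> A" "a' \<in> A" "b \<in> A" "b' \<in> A" "m \<in> S" "m' \<in> S"
    "\<phi> a y = \<phi> b m" "\<phi> a' y = \<phi> b' m'" for a a' b b' m m' y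
  proof -
    have "\<phi> (inv b' \<otimes> a' \<otimes> inv a \<otimes> b) m = \<phi> (inv b') (\<phi> a' (\<phi> (inv a) (\<phi> b m)))"
      using that by (simp add: act_mult act_closed m_assoc)
    also have "\<phi> (inv a) (\<phi> b m) = y" unfolding that(8)[symmetric] using that(1,2) by simp
    also have "\<phi> (inv b') (\<phi> a' y) = m'" unfolding that(9) using that(5,7) by simp
    finally have eq: "\<phi> (inv b' \<otimes> a' \<otimes> inv a \<otimes> b) m = m'" .
    have "inv b' \<otimes> a' \<otimes> inv a \<otimes> b = \<one>"
      by (rule S_discrete[OF that(6) D1[OF that(5,3,2,4)]]) (simp only: eq that(7))
    with eq show ?thesis using that(6) by (simp add: act_one)
  qed
  show ?thesis
  proof (rule that)
    show "N \<in> sets X"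
    proof -
      \<comment> \<open>A code point \<open>z = a m\<close> gives back its marker as
        \<open>a\<inverse> z\<close>, so \<open>N\<close> is a union over the finite set
        \<open>A\<close>.\<close>
      have "N = (\<Union>a\<in>A. {z \<in> space X. \<phi> (inv a) z \<in> S \<and> a \<in> T (\<phi> (inv a) z) ` {..<14}})"
      proof (intro Set.set_eqI iffI)
        fix z assume "z \<in> N"
        then obtain m i where "m \<in> S" "i < 14" "z = \<phi> (T m i) m" "z \<in> space X" unfolding N_def by blast
        then show "z \<in> (\<Union>a\<in>A. {z \<in> space X. \<phi> (inv a) z \<in> S \<and> a \<in> T (\<phi> (inv a) z) ` {..<14}})"
          by (intro UN_I[of "T m i"]) auto
      next
        fix z assume "z \<in> (\<Union>a\<in>A. {z \<in> space X. \<phi> (inv a) z \<in> S \<and> a \<in> T (\<phi> (inv a) z) ` {..<14}})"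
        then obtain a i where a: "a \<in> A" "z \<in> space X" "\<phi> (inv a) z \<in> S" "i < 14" "a = T (\<phi> (inv a) z) i" by blast
        then have "z = \<phi> (T (\<phi> (inv a) z) i) (\<phi> (inv a) z)" by simp
        then show "z \<in> N" unfolding N_def using a by blast
      qed
      moreover have "{z \<in> space X. \<phi> (inv a) z \<in> S \<and> a \<in> T (\<phi> (inv a) z) ` {..<14}} \<in> sets X" if "a \<in> A" for a
      proof -
        have "countable_borel_fun X (\<lambda>z. \<phi> (inv a) z \<in> S \<and> a \<in> T (\<phi> (inv a) z) ` {..<14})"
          using countable_borel_fun_comp2[OF countable_borel_fun_translate[OF countable_borel_fun_mem[OF S]] countable_borel_fun_translate[OF T],
              where h = "\<lambda>s t. s \<and> a \<in> t ` {..<14}"] that by simp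
        then show ?thesis by (simp add: countable_borel_fun_bool)
      qed
      ultimately show ?thesis using A(1) by (auto intro: sets.finite_UN)
    qed
    show "Z' \<in> sets X"
    proof -
      have "{z \<in> space X. \<phi> (inv f) z \<in> S} \<in> sets X" if "f \<in> F" for f
        using countable_borel_fun_translate[OF countable_borel_fun_mem[OF S], of "inv f"] that by (simp add: countable_borel_fun_bool)
      then have "(\<Union>f\<in>F. {z \<in> space X. \<phi> (inv f) z \<in> S}) \<in> sets X" using F by (intro sets.finite_UN) auto
      also have "(\<Union>f\<in>F. {z \<in> space X. \<phi> (inv f) z \<in> S}) = {z \<in> space X. \<exists>f\<in>F. \<phi> (inv f) z \<in> S}" by auto
      finally show ?thesis unfolding Z'_def using Z by auto
    qed
    show "N \<inter> Z = {}" unfolding N_def using TZ by auto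
    show "Z \<subseteq> Z'" unfolding Z'_def by auto
    show "\<phi> v z \<in> Z'" if zv: "z \<in> N" "v \<in> V" for z v
    proof -
      obtain m i where m: "m \<in> S" "i < 14" "z = \<phi> (T m i) m" using zv unfolding N_def by blast
      then have "v \<otimes> T m i \<in> F" unfolding F_def using zv by (intro image_eqI[of _ _ "(v, T m i)"]) auto
      from FZ'[OF this m(1)] show ?thesis using m zv by (simp add: act_mult)
    qed
    show "v = \<one>" if zv: "z \<in> N" "v \<in> V" "\<phi> v z \<in> N" for z v
    proof -
      obtain m i where m: "m \<in> S" "i < 14" "z = \<phi> (T m i) m" using zv unfolding N_def by blast
      obtain m' j where m': "m' \<in> S" "j < 14" "\<phi> v z = \<phi> (T m' j) m'" using zv unfolding N_def by blast
      have car: "T m i \<in> carrier G" "T m' j \<in> carrier G" "v \<in> carrier G" using m m' zv by auto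
      have vt: "\<phi> (v \<otimes> T m i) m = \<phi> (T m' j) m'" using m m' car by (simp add: act_mult)
      have "\<phi> (inv (T m' j) \<otimes> v \<otimes> T m i) m = \<phi> (inv (T m' j)) (\<phi> (v \<otimes> T m i) m)"
        using m car by (simp add: act_mult m_assoc)
      also have "\<dots> = m'" using vt m' car by simp
      finally have eq: "\<phi> (inv (T m' j) \<otimes> v \<otimes> T m i) m = m'" .
      \<comment> \<open>The second part of \<open>D\<close> forces a common marker; the separation
        clause for its code then leaves only \<open>v = \<one>\<close>.\<close>
      have "inv (T m' j) \<otimes> v \<otimes> T m i = \<one>"
        by (rule S_discrete[OF m(1) D2]) (use m(1,2) m'(1,2) zv(2) in \<open>simp_all add: eq\<close>)
      with eq have "m' = m" using m by (simp add: act_one)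
      with vt have "v \<otimes> T m i = T m j" using act_cancel[of "v \<otimes> T m i" "T m j" m] m car by simp
      then have "i = j" using T_sep[of m j i v] m m' zv by auto
      with \<open>v \<otimes> T m i = T m j\<close> show ?thesis using car by (metis r_cancel_one)
    qed
    let ?P' = "P \<union> (\<lambda>p. p \<otimes> g) ` P"
    show "finite ?P'" "?P' \<subseteq> carrier G" using P g by auto
    show "\<exists>p\<in>?P'. \<phi> p x \<notin> Z'" if x: "x \<in> space X" for x
    proof (rule ccontr)
      assume "\<not> (\<exists>p\<in>?P'. \<phi> p x \<notin> Z')"
      then have all: "\<phi> p x \<in> Z'" "\<phi> (p \<otimes> g) x \<in> Z'" if "p \<in> P" for p using that by auto
      have gx: "\<phi> g x \<in> space X" using x g act_closed by blast
      obtain p where p: "p \<in> P" "\<phi> p x \<notin> Z" using synd[OF x] by blast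
      obtain q where q: "q \<in> P" "\<phi> q (\<phi> g x) \<notin> Z" using synd[OF gx] by blast
      have qg: "\<phi> q (\<phi> g x) = \<phi> (q \<otimes> g) x" using x g q by (simp add: act_mult)
      obtain f' where f': "f' \<in> F" "\<phi> (inv f') (\<phi> p x) \<in> S" using p all(1)[of p] unfolding Z'_def by auto
      obtain f where f: "f \<in> F" "\<phi> (inv f) (\<phi> (q \<otimes> g) x) \<in> S" using q qg all(2)[of q] unfolding Z'_def by auto
      let ?s = "\<phi> (inv f') (\<phi> p x)" and ?d = "inv f \<otimes> q \<otimes> g \<otimes> inv p \<otimes> f'"
      have "\<phi> ?d ?s = \<phi> (inv f \<otimes> q \<otimes> g \<otimes> inv p \<otimes> f' \<otimes> (inv f' \<otimes> p)) x"
        using f f' p q g x by (simp add: act_mult)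
      also have "inv f \<otimes> q \<otimes> g \<otimes> inv p \<otimes> f' \<otimes> (inv f' \<otimes> p) = inv f \<otimes> (q \<otimes> g)"
        using f(1) f'(1) p(1) q(1) g by (simp add: m_assoc mult_inv_cancel)
      also have "\<phi> (inv f \<otimes> (q \<otimes> g)) x = \<phi> (inv f) (\<phi> (q \<otimes> g) x)" using f q g x by (simp add: act_mult)
      finally have eq: "\<phi> ?d ?s = \<phi> (inv f) (\<phi> (q \<otimes> g) x)" .
      have "?d = \<one>"
        by (rule S_discrete[OF f'(2) D3[OF f(1) q(1) p(1) f'(1)]]) (simp only: eq f(2))
      moreover have "g = inv q \<otimes> f \<otimes> ?d \<otimes> inv f' \<otimes> p"
        using f(1) f'(1) p(1) q(1) g by (simp add: m_assoc mult_inv_cancel)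
      ultimately have "g = inv q \<otimes> f \<otimes> inv f' \<otimes> p"
        using f(1) f'(1) p(1) q(1) by simp
      then show False using g_notin f(1) f'(1) p(1) q(1) by force
    qed
    \<comment> \<open>Any two points of \<open>A c m\<close> are related by an element of
      \<open>A A\<inverse>\<close>, so \<open>L\<close> meets this set at most once.\<close>
    let ?Q = "(\<lambda>(a, b). a \<otimes> inv b) ` (A \<times> A)"
    show "finite ?Q" "?Q \<subseteq> carrier G" using A by auto
    show "inv q \<in> ?Q" if "q \<in> ?Q" for q
      using that by (force simp: inv_mult_group)

    \<comment> \<open>The pattern at a marker does not recur\<close>
    fix L x
    assume L: "L \<subseteq> space X" "L \<inter> Z' = {}" and L_sep: "\<And>z q. \<lbrakk>z \<in> L; q \<in> ?Q; \<phi> q z \<in> L\<rbrakk> \<Longrightarrow> q = \<one>"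
      and x: "x \<in> space X"
    let ?M = "E \<union> N \<union> L"
    show "\<exists>h\<in>carrier G. (\<phi> h x \<in> ?M) \<noteq> (\<phi> h (\<phi> \<gamma> x) \<in> ?M)"
    proof (rule ccontr)
      assume "\<not> ?thesis"
      then have same: "\<phi> h x \<in> ?M \<longleftrightarrow> \<phi> h (\<phi> \<gamma> x) \<in> ?M" if "h \<in> carrier G" for h using that by blast
      obtain d where d: "d \<in> B" "\<phi> d x \<in> S" using S_maximal[OF x] unfolding B_def by blast
      define m where "m = \<phi> d x"
      define c where "c = d \<otimes> \<gamma> \<otimes> inv d"
      have m: "m \<in> S" "m \<in> space X" using d unfolding m_def by auto
      have c: "c \<in> C" "c \<in> carrier G" using d \<gamma> unfolding c_def C_def by auto
      have c1: "c \<noteq> \<one>"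
      proof
        assume "c = \<one>"
        then have "inv d \<otimes> c \<otimes> d = \<one>" using d by simp
        then show False using d \<gamma> unfolding c_def by (simp add: m_assoc flip: m_assoc[of "inv d" d])
      qed
      have agree: "\<phi> a m \<in> ?M \<longleftrightarrow> \<phi> (a \<otimes> c) m \<in> ?M" if a: "a \<in> A" for a
      proof -
        have "\<phi> a m = \<phi> (a \<otimes> d) x" using a d x unfolding m_def by (simp add: act_mult)
        moreover have "\<phi> (a \<otimes> c) m = \<phi> (a \<otimes> d) (\<phi> \<gamma> x)"
          using a d x \<gamma> unfolding m_def c_def by (simp add: act_mult m_assoc)
        ultimately show ?thesis using same[of "a \<otimes> d"] a d by simp
      qed
      let ?n = "{..<14::nat}"
      have car [simp]: "T m i \<in> carrier G" if "i < 14" for i using that m by simp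
      \<comment> \<open>Later stages are absent from \<open>A m \<subseteq> Z'\<close>, and by
        \<open>base\<close> no other marker has code points in \<open>A m\<close>.\<close>
      have at_m: "\<phi> a m \<in> ?M \<longleftrightarrow> \<phi> a m \<in> E \<or> a \<in> T m ` ?n" if a: "a \<in> A" for a
      proof
        assume "\<phi> a m \<in> ?M"
        moreover have "\<phi> a m \<notin> L" using FZ'[of a m] AF a m L by auto
        moreover have "a \<in> T m ` ?n" if in_N: "\<phi> a m \<in> N"
        proof -
          obtain m' i where m': "m' \<in> S" "i < 14" "\<phi> a m = \<phi> (T m' i) m'"
            using in_N unfolding N_def by blast
          have "m' = m" using base[OF m(2) a a a _ m(1) m'(1) refl m'(3)] m' by simp
          then show ?thesis using act_cancel[of a "T m i" m] m m' a by auto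
        qed
        ultimately show "\<phi> a m \<in> E \<or> a \<in> T m ` ?n" by blast
      next
        assume "\<phi> a m \<in> E \<or> a \<in> T m ` ?n"
        then show "\<phi> a m \<in> ?M" unfolding N_def using m act_closed by auto
      qed
      have few: "card (excess m c) \<le> 6"
      proof (rule ccontr)
        assume "\<not> card (excess m c) \<le> 6"
        then have ge: "7 \<le> card (excess m c)" by simp
        define Y where "Y = (SOME Y. Y \<subseteq> excess m c \<and> card Y = 7)"
        have Y: "Y \<subseteq> excess m c" "card Y = 7" using seven[OF ge] unfolding Y_def by auto
        have "Y \<in> W m" unfolding W_def Y_def using c ge by auto
        then have lt: "card {i \<in> ?n. T m i \<in> Y} < 7"
          by (intro generic_tuple_hits[OF T_gen[OF m(2)]] UnI1)
        have "Y \<subseteq> T m ` {i \<in> ?n. T m i \<in> Y}"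
        proof
          fix a assume a: "a \<in> Y"
          then have "a \<in> A" "\<phi> (a \<otimes> c) m \<in> E" "\<phi> a m \<notin> E" using Y unfolding excess_def by auto
          then have "a \<in> T m ` ?n" using agree at_m by blast
          then show "a \<in> T m ` {i \<in> ?n. T m i \<in> Y}" using a by blast
        qed
        then have "card Y \<le> card {i \<in> ?n. T m i \<in> Y}" by (rule surj_card_le[rotated]) simp
        then show False using lt Y by simp
      qed
      define I\<^sub>E I\<^sub>N I\<^sub>L where "I\<^sub>E = {i \<in> ?n. \<phi> (T m i \<otimes> c) m \<in> E}"
        and "I\<^sub>N = {i \<in> ?n. \<phi> (T m i \<otimes> c) m \<in> N}" and "I\<^sub>L = {i \<in> ?n. \<phi> (T m i \<otimes> c) m \<in> L}"
      have fin: "finite I\<^sub>E" "finite I\<^sub>N" "finite I\<^sub>L" unfolding I\<^sub>E_def I\<^sub>N_def I\<^sub>L_def by auto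
      \<comment> \<open>Code points avoid \<open>Z\<close>, which contains \<open>E\<close>, so
        entries matched by \<open>E\<close> belong to the excess.\<close>
      have "card I\<^sub>E \<le> card (excess m c)"
      proof (rule card_inj_on_le)
        show "inj_on (T m) I\<^sub>E" unfolding I\<^sub>E_def by (intro inj_onI T_inj[OF m(2)]) auto
        show "T m ` I\<^sub>E \<subseteq> excess m c" unfolding I\<^sub>E_def excess_def using m TZ OZ by auto
      qed (rule excess_fin)
      moreover have "card I\<^sub>L \<le> 1"
      proof -
        have "i = j" if ij: "i \<in> I\<^sub>L" "j \<in> I\<^sub>L" for i j
        proof -
          have lt: "i < 14" "j < 14" using ij unfolding I\<^sub>L_def by auto
          have "\<phi> (T m i \<otimes> inv (T m j)) (\<phi> (T m j \<otimes> c) m) = \<phi> (T m i \<otimes> c) m"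
            using lt m c by (simp add: act_mult m_assoc) (simp flip: m_assoc)
          then have "T m i \<otimes> inv (T m j) = \<one>"
            using ij lt m by (intro L_sep[of "\<phi> (T m j \<otimes> c) m"]) (auto simp: I\<^sub>L_def)
          then have "T m i = T m j" using lt by (metis car inv_equality inv_inv inv_closed)
          then show ?thesis by (rule T_inj[OF m(2) lt])
        qed
        then show ?thesis using fin(3) by (simp add: card_le_Suc0_iff_eq)
      qed
      moreover have "?n = I\<^sub>E \<union> I\<^sub>L \<union> I\<^sub>N"
      proof -
        have "\<phi> (T m i \<otimes> c) m \<in> ?M" if "i < 14" for i
          using agree[of "T m i"] at_m[of "T m i"] that m by auto
        then show ?thesis unfolding I\<^sub>E_def I\<^sub>N_def I\<^sub>L_def by auto
      qed
      then have "14 \<le> card I\<^sub>E + card I\<^sub>L + card I\<^sub>N"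
        using card_Un_le[of "I\<^sub>E \<union> I\<^sub>L" I\<^sub>N] card_Un_le[of "I\<^sub>E" I\<^sub>L] by (metis (no_types, lifting) add_le_mono1 card_lessThan order_trans)
      ultimately have N7: "7 \<le> card I\<^sub>N" using few by linarith
      then obtain i\<^sub>0 where i0: "i\<^sub>0 \<in> I\<^sub>N" by (metis card.empty equals0I not_numeral_le_zero)
      then obtain m' j\<^sub>0 where m': "m' \<in> S" "j\<^sub>0 < 14" "\<phi> (T m i\<^sub>0 \<otimes> c) m = \<phi> (T m' j\<^sub>0) m'"
        unfolding I\<^sub>N_def N_def by blast
      have i0': "i\<^sub>0 < 14" using i0 unfolding I\<^sub>N_def by simp
      have car' [simp]: "T m' j \<in> carrier G" if "j < 14" for j using that m' by simp
      define \<sigma> where "\<sigma> = inv (T m' j\<^sub>0) \<otimes> T m i\<^sub>0 \<otimes> c"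
      have \<sigma>: "\<sigma> \<in> carrier G" unfolding \<sigma>_def using m' i0' c by simp
      have m'\<sigma>: "m' = \<phi> \<sigma> m"
      proof -
        have "\<phi> \<sigma> m = \<phi> (inv (T m' j\<^sub>0)) (\<phi> (T m i\<^sub>0 \<otimes> c) m)"
          unfolding \<sigma>_def using m m'(2) i0' c by (simp add: act_mult m_assoc)
        also have "\<dots> = m'" unfolding m'(3) using m'(1,2) by simp
        finally show ?thesis by simp
      qed
      \<comment> \<open>Applied at the point \<open>c m\<close>, \<open>base\<close> shows that a
        single marker \<open>m'\<close> accounts for all entries in
        \<open>I\<^sub>N\<close>.\<close>
      have shift: "\<exists>j<14. T m i \<otimes> c = T m' j \<otimes> \<sigma>" if i: "i \<in> I\<^sub>N" for i
      proof -
        have lt: "i < 14" using i unfolding I\<^sub>N_def by simp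
        obtain m'' j where m'': "m'' \<in> S" "j < 14" "\<phi> (T m i \<otimes> c) m = \<phi> (T m'' j) m''"
          using i unfolding I\<^sub>N_def N_def by blast
        have "m'' = m'"
          using base[of "\<phi> c m" "T m i\<^sub>0" "T m i" "T m' j\<^sub>0" "T m'' j" m' m''] m m' m'' c lt i0'
          by (simp add: act_mult act_closed)
        then have "\<phi> (T m i \<otimes> c) m = \<phi> (T m' j \<otimes> \<sigma>) m"
          using m'' m'\<sigma> m \<sigma> by (simp add: act_mult)
        then show ?thesis using act_cancel[of "T m i \<otimes> c" "T m' j \<otimes> \<sigma>" m] m m'' lt c \<sigma> by auto
      qed
      have JJ: "(\<sigma>, \<sigma> \<otimes> inv c) \<in> J" "(inv \<sigma>, c \<otimes> inv \<sigma>) \<in> J"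
        unfolding \<sigma>_def using J1 J2 m m' i0' c by simp_all
      \<comment> \<open>For \<open>m' = m\<close> the code of \<open>m\<close> would match its own
        translate in at least 7 entries. Otherwise the marker of larger colour chose its code in
        view of the other one, with fewer than 7 matches allowed.\<close>
      show False
      proof (cases "\<sigma> = \<one>")
        case True
        then have "m' = m" using m'\<sigma> m by (simp add: act_one)
        show False
        proof (rule generic_tuple_no_shift[OF T_gen[OF m(2)] car c(2) c1])
          show "I\<^sub>N \<subseteq> ?n" unfolding I\<^sub>N_def by auto
          show "3 \<le> card I\<^sub>N" using N7 by simp
          show "\<exists>j<14. T m i \<otimes> c = T m j" if "i \<in> I\<^sub>N" for i
            using shift[OF that] True \<open>m' = m\<close> by (metis car r_one)
        qed
      next
        case False
        then have "\<kappa> m' \<noteq> \<kappa> m" using \<kappa>_neq[of \<sigma> m] JJ m'\<sigma> m by force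
        then consider "\<kappa> m' < \<kappa> m" | "\<kappa> m < \<kappa> m'" by linarith
        then show False
        proof cases
          case 1
          let ?Y = "(\<lambda>j. T (\<phi> \<sigma> m) j \<otimes> (\<sigma> \<otimes> inv c)) ` ?n"
          have "card {i \<in> ?n. T m i \<in> ?Y} < 7"
            using JJ(1) 1 unfolding m'\<sigma> by (intro generic_tuple_hits[OF T_gen[OF m(2)]]) blast
          moreover have "I\<^sub>N \<subseteq> {i \<in> ?n. T m i \<in> ?Y}"
          proof
            fix i assume i: "i \<in> I\<^sub>N"
            then have lt: "i < 14" unfolding I\<^sub>N_def by simp
            obtain j where j: "j < 14" "T m i \<otimes> c = T m' j \<otimes> \<sigma>" using shift[OF i] by blast
            have "T m i = T m i \<otimes> c \<otimes> inv c" using lt c by (simp add: m_assoc)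
            also have "\<dots> = T m' j \<otimes> (\<sigma> \<otimes> inv c)" unfolding j(2) using j(1) \<sigma> c by (simp add: m_assoc)
            finally show "i \<in> {i \<in> ?n. T m i \<in> ?Y}" using lt j(1) m'\<sigma> by auto
          qed
          then have "card I\<^sub>N \<le> card {i \<in> ?n. T m i \<in> ?Y}" by (intro card_mono) auto
          ultimately show False using N7 by linarith
        next
          case 2
          have m_eq: "\<phi> (inv \<sigma>) m' = m" unfolding m'\<sigma> using \<sigma> m by simp
          let ?Y = "(\<lambda>i. T (\<phi> (inv \<sigma>) m') i \<otimes> (c \<otimes> inv \<sigma>)) ` ?n"
          have "\<kappa> (\<phi> (inv \<sigma>) m') < \<kappa> m'" using 2 m_eq by simp
          then have lt7: "card {j \<in> ?n. T m' j \<in> ?Y} < 7"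
            using JJ(2) by (intro generic_tuple_hits[OF T_gen[OF S_space[OF m'(1)]]]) blast
          \<comment> \<open>The bound concerns entries of the code of \<open>m'\<close>, whereas
            \<open>I\<^sub>N\<close> indexes entries of the code of \<open>m\<close>; the injection
            \<open>s\<close> transports the matches.\<close>
          obtain s where s: "\<And>i. i \<in> I\<^sub>N \<Longrightarrow> s i < 14 \<and> T m i \<otimes> c = T m' (s i) \<otimes> \<sigma>"
            using shift by metis
          have "card I\<^sub>N \<le> card {j \<in> ?n. T m' j \<in> ?Y}"
          proof (rule card_inj_on_le[of s])
            show "inj_on s I\<^sub>N"
            proof (rule inj_onI)
              fix i j assume ij: "i \<in> I\<^sub>N" "j \<in> I\<^sub>N" "s i = s j"
              then have lt: "i < 14" "j < 14" unfolding I\<^sub>N_def by auto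
              have "T m i \<otimes> c = T m j \<otimes> c" using s ij by metis
              then have "T m i = T m j" using lt c by simp
              then show "i = j" by (rule T_inj[OF m(2) lt])
            qed
            show "s ` I\<^sub>N \<subseteq> {j \<in> ?n. T m' j \<in> ?Y}"
            proof
              fix j assume "j \<in> s ` I\<^sub>N"
              then obtain i where i: "i \<in> I\<^sub>N" "j = s i" by blast
              then have lt: "i < 14" "j < 14" using s[OF i(1)] unfolding I\<^sub>N_def by simp_all
              have "T m' j = T m' j \<otimes> \<sigma> \<otimes> inv \<sigma>" using lt \<sigma> by (simp add: m_assoc)
              also have "T m' j \<otimes> \<sigma> = T m i \<otimes> c" using s[OF i(1)] i(2) by simp
              also have "T m i \<otimes> c \<otimes> inv \<sigma> = T m i \<otimes> (c \<otimes> inv \<sigma>)" using lt \<sigma> c by (simp add: m_assoc)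
              finally show "j \<in> {j \<in> ?n. T m' j \<in> ?Y}" using lt m_eq by auto
            qed
          qed simp
          then show False using N7 lt7 by linarith
        qed
      qed
    qed
  qed
qed

section \<open>The equivariant map\<close>

text \<open>\<open>extension\<close> is iterated along an enumeration of the nonidentity elements,
  and \<open>M\<close> is the union of all parts added. For each stage, the union of all later parts
  takes the role of \<open>L\<close>.\<close>

lemma separating_set:
  assumes count: "countable (carrier G)"
  obtains M where "M \<in> sets X"
    and "\<And>x \<gamma>. \<lbrakk>x \<in> space X; \<gamma> \<in> carrier G; \<gamma> \<noteq> \<one>\<rbrakk> \<Longrightarrow>
      \<exists>h\<in>carrier G. (\<phi> h x \<in> M) \<noteq> (\<phi> h (\<phi> \<gamma> x) \<in> M)"
proof (cases "space X = {}")
  case True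
  then show thesis using that[of "{}"] by simp
next
  case ne: False
  define valid where "valid = (\<lambda>(E, Z, P, V). E \<in> sets X \<and> Z \<in> sets X \<and> E \<subseteq> Z \<and> finite P \<and>
    P \<subseteq> carrier G \<and> (\<forall>x\<in>space X. \<exists>p\<in>P. \<phi> p x \<notin> Z) \<and> finite V \<and> V \<subseteq> carrier G \<and> \<one> \<in> V)"
  \<comment> \<open>The conclusion of \<open>extension\<close> as a relation between states, for
    dependent choice. Quantifying over \<open>L\<close> makes a stage immune to later ones;
    \<open>V\<close> accumulates the sets \<open>Q\<close>, so that later parts respect the demands
    of all earlier stages.\<close>
  define next_stage where "next_stage \<gamma> = (\<lambda>(E, Z, P :: 'g set, V) (E', Z', P' :: 'g set, V') N Q.
    N \<in> sets X \<and> N \<inter> Z = {} \<and> Z \<subseteq> Z' \<and> E' = E \<union> N \<and> V' = V \<union> Q \<and>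
    (\<forall>z\<in>N. \<forall>v\<in>V. \<phi> v z \<in> Z' \<and> (\<phi> v z \<in> N \<longrightarrow> v = \<one>)) \<and>
    Q \<subseteq> carrier G \<and> (\<forall>q\<in>Q. inv q \<in> Q) \<and>
    (\<forall>L. L \<subseteq> space X \<and> L \<inter> Z' = {} \<and> (\<forall>z\<in>L. \<forall>q\<in>Q. \<phi> q z \<in> L \<longrightarrow> q = \<one>) \<longrightarrow>
      (\<forall>x\<in>space X. \<exists>h\<in>carrier G. (\<phi> h x \<in> E' \<union> L) \<noteq> (\<phi> h (\<phi> \<gamma> x) \<in> E' \<union> L))))"
    for \<gamma> :: 'g
  have "infinite (carrier G - {\<one>})" using infinite_carrier by simp
  then have ne1: "carrier G - {\<one>} \<noteq> {}" by (metis finite.emptyI)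
  define \<gamma> where "\<gamma> = from_nat_into (carrier G - {\<one>})"
  have \<gamma>: "\<gamma> n \<in> carrier G" "\<gamma> n \<noteq> \<one>" for n
    using from_nat_into[OF ne1, of n] unfolding \<gamma>_def by auto
  have \<gamma>_surj: "\<exists>n. \<gamma> n = g" if "g \<in> carrier G" "g \<noteq> \<one>" for g
    using from_nat_into_surj[of "carrier G - {\<one>}" g] count that unfolding \<gamma>_def by auto
  have "\<exists>s'. valid s' \<and> (\<exists>N Q. next_stage (\<gamma> n) s s' N Q)" if "valid s" for s n
  proof -
    obtain E Z P V where s: "s = (E, Z, P, V)" by (cases s)
    have hyps: "E \<in> sets X" "Z \<in> sets X" "E \<subseteq> Z" "finite P" "P \<subseteq> carrier G"
      "\<And>x. x \<in> space X \<Longrightarrow> \<exists>p\<in>P. \<phi> p x \<notin> Z" "finite V" "V \<subseteq> carrier G" "\<one> \<in> V"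
      using that unfolding valid_def s by auto
    show ?thesis
    proof (rule extension[OF hyps \<gamma>(1)[of n] \<gamma>(2)[of n] ne])
      fix N Z' P' Q
      assume e: "N \<in> sets X" "Z' \<in> sets X" "N \<inter> Z = {}" "Z \<subseteq> Z'"
        "\<And>z v. \<lbrakk>z \<in> N; v \<in> V\<rbrakk> \<Longrightarrow> \<phi> v z \<in> Z'"
        "\<And>z v. \<lbrakk>z \<in> N; v \<in> V; \<phi> v z \<in> N\<rbrakk> \<Longrightarrow> v = \<one>"
        "finite P'" "P' \<subseteq> carrier G" "\<And>x. x \<in> space X \<Longrightarrow> \<exists>p\<in>P'. \<phi> p x \<notin> Z'"
        "finite Q" "Q \<subseteq> carrier G" "\<And>q. q \<in> Q \<Longrightarrow> inv q \<in> Q"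
        "\<And>L x. \<lbrakk>L \<subseteq> space X; L \<inter> Z' = {}; \<And>z q. \<lbrakk>z \<in> L; q \<in> Q; \<phi> q z \<in> L\<rbrakk> \<Longrightarrow> q = \<one>; x \<in> space X\<rbrakk>
          \<Longrightarrow> \<exists>h\<in>carrier G. (\<phi> h x \<in> E \<union> N \<union> L) \<noteq> (\<phi> h (\<phi> (\<gamma> n) x) \<in> E \<union> N \<union> L)"
      have "N \<subseteq> Z'"
      proof
        fix z assume "z \<in> N"
        then show "z \<in> Z'" using e(5)[of z \<one>] hyps(9) sets.sets_into_space[OF e(1)] by (auto simp: act_one)
      qed
      then have "valid (E \<union> N, Z', P', V \<union> Q)" using e(1,2,4,7-11) hyps unfolding valid_def by auto
      moreover have "next_stage (\<gamma> n) s (E \<union> N, Z', P', V \<union> Q) N Q"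
        unfolding next_stage_def s prod.case
      proof (intro conjI allI impI ballI; (elim conjE)?)
        fix L x assume "L \<subseteq> space X" "L \<inter> Z' = {}" "\<forall>z\<in>L. \<forall>q\<in>Q. \<phi> q z \<in> L \<longrightarrow> q = \<one>" "x \<in> space X"
        then show "\<exists>h\<in>carrier G. (\<phi> h x \<in> E \<union> N \<union> L) \<noteq> (\<phi> h (\<phi> (\<gamma> n) x) \<in> E \<union> N \<union> L)"
          by (intro e(13)) blast+
      qed (use e(1,3-6,11,12) in simp_all)
      ultimately show ?thesis by blast
    qed assumption
  qed
  moreover have "valid ({}, {}, {\<one>}, {\<one>})" unfolding valid_def by auto
  ultimately obtain s where s0: "s 0 = ({}, {}, {\<one>}, {\<one>})" and "\<And>n. valid (s n)"
    and "\<And>n. \<exists>N Q. next_stage (\<gamma> n) (s n) (s (Suc n)) N Q"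
    \<comment> \<open>The implication on \<open>n = 0\<close> pins the initial state, as dependent
      choice only ensures a predicate at each index.\<close>
    using dependent_nat_choice[of "\<lambda>n s. valid s \<and> (n = 0 \<longrightarrow> s = ({}, {}, {\<one>}, {\<one>}))"
        "\<lambda>n s s'. \<exists>N Q. next_stage (\<gamma> n) s s' N Q"] by (metis nat.distinct(1))
  then obtain N Q where nxt: "\<And>n. next_stage (\<gamma> n) (s n) (s (Suc n)) (N n) (Q n)" by metis
  define E Z V where "E n = fst (s n)" and "Z n = fst (snd (s n))" and "V n = snd (snd (snd (s n)))" for n
  have N: "N n \<in> sets X" "N n \<inter> Z n = {}" and Z_Suc: "Z n \<subseteq> Z (Suc n)"
    and E_Suc: "E (Suc n) = E n \<union> N n" and V_Suc: "V (Suc n) = V n \<union> Q n"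
    and VN: "\<And>z v. \<lbrakk>z \<in> N n; v \<in> V n\<rbrakk> \<Longrightarrow> \<phi> v z \<in> Z (Suc n) \<and> (\<phi> v z \<in> N n \<longrightarrow> v = \<one>)"
    and Q: "Q n \<subseteq> carrier G" "\<And>q. q \<in> Q n \<Longrightarrow> inv q \<in> Q n"
    and split: "\<forall>L. L \<subseteq> space X \<and> L \<inter> Z (Suc n) = {} \<and>
        (\<forall>z\<in>L. \<forall>q\<in>Q n. \<phi> q z \<in> L \<longrightarrow> q = \<one>) \<longrightarrow>
      (\<forall>x\<in>space X. \<exists>h\<in>carrier G. (\<phi> h x \<in> E (Suc n) \<union> L) \<noteq> (\<phi> h (\<phi> (\<gamma> n) x) \<in> E (Suc n) \<union> L))" for n
    using nxt[of n] unfolding next_stage_def E_def Z_def V_def case_prod_beta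
    by (elim conjE; (assumption | simp))+
  have Z_mono: "Z i \<subseteq> Z j" if "i \<le> j" for i j using lift_Suc_mono_le[of Z, OF Z_Suc that] .
  have V_mono: "V i \<subseteq> V j" if "i \<le> j" for i j using lift_Suc_mono_le[of V, OF _ that] V_Suc by blast
  have QV: "Q n \<subseteq> V i" if "n < i" for n i using V_mono[of "Suc n" i] V_Suc[of n] that by auto
  have N_space: "N n \<subseteq> space X" for n using sets.sets_into_space[OF N(1)] .
  have EN: "E n = (\<Union>i<n. N i)" for n
  proof (induction n)
    case 0
    then show ?case by (simp add: E_def s0)
  next
    case (Suc n)
    then show ?case by (auto simp: E_Suc lessThan_Suc)
  qed
  show thesis
  proof (rule that)
    show "(\<Union>n. N n) \<in> sets X" using N(1) by blast
    fix x g assume x: "x \<in> space X" and g: "g \<in> carrier G" "g \<noteq> \<one>"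
    obtain n where n: "\<gamma> n = g" using \<gamma>_surj[OF g] by blast
    define L where "L = (\<Union>i\<in>{n<..}. N i)"
    have "L \<subseteq> space X" using N_space unfolding L_def by auto
    moreover have "L \<inter> Z (Suc n) = {}"
    proof -
      have "N i \<inter> Z (Suc n) = {}" if "n < i" for i using N(2)[of i] Z_mono[of "Suc n" i] that by auto
      then show ?thesis unfolding L_def by auto
    qed
    moreover have "\<forall>z\<in>L. \<forall>q\<in>Q n. \<phi> q z \<in> L \<longrightarrow> q = \<one>"
    proof (intro ballI impI)
      fix z q assume z: "z \<in> L" "q \<in> Q n" "\<phi> q z \<in> L"
      obtain i j where i: "n < i" "z \<in> N i" and j: "n < j" "\<phi> q z \<in> N j" using z unfolding L_def by auto
      have q: "q \<in> carrier G" using z Q by auto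
      \<comment> \<open>\<open>Q n\<close>-translates of the part added at stage \<open>i\<close>
        lie in \<open>Z (Suc i)\<close>, which later parts avoid. The case \<open>j < i\<close>
        below is reduced to this one by passing to \<open>inv q\<close>.\<close>
      have lt: False if "n < i" "i < j" "p \<in> Q n" "y \<in> N i" "\<phi> p y \<in> N j" for i j p y
      proof -
        have "\<phi> p y \<in> Z (Suc i)" using VN[of y i p] QV[of n i] that by auto
        then show False using Z_mono[of "Suc i" j] N(2)[of j] that by auto
      qed
      consider "i < j" | "i = j" | "j < i" by linarith
      then show "q = \<one>"
      proof cases
        case 1
        then show ?thesis using lt[of i j q z] i j z by blast
      next
        case 2
        then show ?thesis using VN[of z i q] QV[of n i] i j z by auto
      next
        case 3
        have "\<phi> (inv q) (\<phi> q z) = z" using q i N_space[of i] by (simp add: subset_iff)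
        then show ?thesis using lt[OF j(1) 3 Q(2)[OF z(2)] j(2)] i(2) by simp
      qed
    qed
    moreover have "E (Suc n) \<union> L = (\<Union>n. N n)"
    proof -
      have "{..<Suc n} \<union> {n<..} = UNIV" by auto
      then show ?thesis unfolding EN L_def by (metis UN_Un)
    qed
    ultimately show "\<exists>h\<in>carrier G. (\<phi> h x \<in> (\<Union>n. N n)) \<noteq> (\<phi> h (\<phi> g x) \<in> (\<Union>n. N n))"
      using split[of n, THEN spec, of L] x unfolding n by simp
  qed
qed

text \<open>There are only countably many cylinders, and each open set of the shift is a union of
  them, so the coordinates decide measurability.\<close>

lemma measurable_into_free_part:
  assumes count: "countable (carrier G)"
    and f: "\<And>x. x \<in> space X \<Longrightarrow> f x \<in> free_part G"
    and coord: "\<And>g b. g \<in> carrier G \<Longrightarrow> {x \<in> space X. f x g = b} \<in> sets X"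
  shows "f \<in> X \<rightarrow>\<^sub>M free_part_borel G"
  unfolding free_part_borel_def borel_of_def
proof (rule measurable_measure_of)
  let ?T = "subtopology (shift_topology G) (free_part G)"
  show "{U. openin ?T U} \<subseteq> Pow (topspace ?T)" using openin_subset by blast
  show "f \<in> space X \<rightarrow> topspace ?T" using f free_part_subset[of G] by auto
  fix U assume "U \<in> {U. openin ?T U}"
  then obtain W where W: "openin (shift_topology G) W" "U = W \<inter> free_part G"
    by (auto simp: openin_subtopology)
  let ?C = "{F. finite F \<and> F \<subseteq> carrier G}"
  let ?cyl = "\<lambda>(F, A). {w \<in> carrier G \<rightarrow>\<^sub>E UNIV. \<forall>h\<in>F. w h \<longleftrightarrow> h \<in> A}"
  let ?I = "{p \<in> ?C \<times> ?C. ?cyl p \<subseteq> W}"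
  have cover: "\<exists>p\<in>?I. w \<in> ?cyl p" if "w \<in> W" for w
  proof -
    have "\<exists>B. finite {i \<in> carrier G. B i \<noteq> UNIV} \<and> w \<in> Pi\<^sub>E (carrier G) B \<and> Pi\<^sub>E (carrier G) B \<subseteq> W"
      using W(1) that unfolding shift_topology_def openin_product_topology_alt by simp
    then obtain B where B: "finite {i \<in> carrier G. B i \<noteq> UNIV}" "w \<in> Pi\<^sub>E (carrier G) B"
        "Pi\<^sub>E (carrier G) B \<subseteq> W" by (elim exE conjE)
    let ?F = "{i \<in> carrier G. B i \<noteq> UNIV}"
    let ?A = "{i \<in> ?F. w i}"
    have sub: "?cyl (?F, ?A) \<subseteq> Pi\<^sub>E (carrier G) B"
    proof
      fix w' assume w': "w' \<in> ?cyl (?F, ?A)"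
      have "w' i \<in> B i" if i: "i \<in> carrier G" for i
      proof (cases "B i = UNIV")
        case False
        then have "w' i = w i" using w' i by auto
        then show ?thesis using B(2) i by auto
      qed simp
      then show "w' \<in> Pi\<^sub>E (carrier G) B" using w' by (auto simp: PiE_iff)
    qed
    have "finite ?A" by (rule finite_subset[OF _ B(1)]) auto
    then have "(?F, ?A) \<in> ?I" using B(1) subset_trans[OF sub B(3)] by simp
    moreover have "w \<in> ?cyl (?F, ?A)" using B(2) by auto
    ultimately show ?thesis by (rule bexI[rotated])
  qed
  have "f -` U \<inter> space X = (\<Union>p\<in>?I. {x \<in> space X. f x \<in> ?cyl p})"
  proof (intro Set.set_eqI iffI)
    fix x assume x: "x \<in> f -` U \<inter> space X"
    then have "f x \<in> W" using W by auto
    from cover[OF this] x show "x \<in> (\<Union>p\<in>?I. {x \<in> space X. f x \<in> ?cyl p})" by blast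
  next
    fix x assume "x \<in> (\<Union>p\<in>?I. {x \<in> space X. f x \<in> ?cyl p})"
    then have "x \<in> space X" "f x \<in> W" by blast+
    then show "x \<in> f -` U \<inter> space X" using W f by auto
  qed
  also have "\<dots> \<in> sets X"
  proof (rule sets.countable_UN'')
    show "countable ?I"
      by (rule countable_subset[of _ "?C \<times> ?C"])
        (use countable_Collect_finite_subset[OF count] in \<open>auto intro!: countable_SIGMA\<close>)
    fix p assume "p \<in> ?I"
    then obtain F A where p: "p = (F, A)" "finite F" "F \<subseteq> carrier G" by auto
    have "{x \<in> space X. f x \<in> ?cyl p} = {x \<in> space X. \<forall>h\<in>F. f x h = (h \<in> A)}"
      using f by (auto simp: p(1) free_part_def)
    also have "\<dots> \<in> sets X"
      using p(2,3) coord by (intro sets.sets_Collect_finite_All) auto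
    finally show "{x \<in> space X. f x \<in> ?cyl p} \<in> sets X" .
  qed
  finally show "f -` U \<inter> space X \<in> sets X" .
qed

theorem equivariant_map_to_free_part:
  assumes count: "countable (carrier G)"
  obtains f where "f \<in> X \<rightarrow>\<^sub>M free_part_borel G" and "\<And>x. x \<in> space X \<Longrightarrow> f x \<in> free_part G"
    and "\<And>g x. \<lbrakk>g \<in> carrier G; x \<in> space X\<rbrakk> \<Longrightarrow> f (\<phi> g x) = shift G g (f x)"
proof -
  obtain M where M: "M \<in> sets X" and sep: "\<And>x \<gamma>. \<lbrakk>x \<in> space X; \<gamma> \<in> carrier G; \<gamma> \<noteq> \<one>\<rbrakk> \<Longrightarrow>
      \<exists>h\<in>carrier G. (\<phi> h x \<in> M) \<noteq> (\<phi> h (\<phi> \<gamma> x) \<in> M)"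
    using separating_set[OF count] by blast
  define f where "f x = (\<lambda>g\<in>carrier G. \<phi> (inv g) x \<in> M)" for x
  have equiv: "f (\<phi> g x) = shift G g (f x)" if "g \<in> carrier G" "x \<in> space X" for g x
    using that by (auto simp: f_def shift_def fun_eq_iff act_mult inv_mult_group)
  have free: "f x \<in> free_part G" if x: "x \<in> space X" for x
    unfolding free_part_def
  proof (intro CollectI conjI ballI impI notI)
    show "f x \<in> carrier G \<rightarrow>\<^sub>E UNIV" by (simp add: f_def)
    fix g assume g: "g \<in> carrier G" "g \<noteq> \<one>" and eq: "shift G g (f x) = f x"
    obtain h where h: "h \<in> carrier G" "(\<phi> h x \<in> M) \<noteq> (\<phi> h (\<phi> g x) \<in> M)" using sep[OF x g] by blast
    \<comment> \<open>The coordinate of \<open>f x\<close> at \<open>inv h\<close> tells whether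
      \<open>h x\<close> lies in \<open>M\<close>.\<close>
    have "f (\<phi> g x) (inv h) = f x (inv h)" using eq equiv[OF g(1) x] by simp
    then show False using h by (simp add: f_def)
  qed
  have coord: "{x \<in> space X. f x g = b} \<in> sets X" if g: "g \<in> carrier G" for g b
  proof -
    have "countable_borel_fun X (\<lambda>x. \<phi> (inv g) x \<in> M)"
      using countable_borel_fun_translate[OF countable_borel_fun_mem[OF M], of "inv g"] g by simp
    then show ?thesis using g by (simp add: f_def countable_borel_fun_def)
  qed
  show thesis
    by (rule that[OF measurable_into_free_part[OF count free coord] free equiv])
qed

section \<open>Orbit equivalence relations and the transfer of structures\<close>

lemma orbit_equiv_rel_eq: "orbit_equiv_rel G (space X) \<phi> = {(x, y). x \<in> space X \<and> (\<exists>g\<in>carrier G. y = \<phi> g x)}"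
  by (auto simp: orbit_equiv_rel_def orbit_def)

text \<open>The relation is a countable union of graphs of translations, and such a graph is Borel
  because \<open>y = g x\<close> holds iff no \<open>U n\<close> separates the two points.\<close>

lemma countable_borel_equiv_rel_orbit:
  assumes count: "countable (carrier G)"
  shows "countable_borel_equiv_rel X (orbit_equiv_rel G (space X) \<phi>)" (is "countable_borel_equiv_rel X ?E")
proof -
  obtain U :: "nat \<Rightarrow> 'x set" where "range U \<subseteq> sets X \<and>
      (\<forall>x\<in>space X. \<forall>y\<in>space X. x \<noteq> y \<longrightarrow> (\<exists>n. x \<in> U n \<longleftrightarrow> y \<notin> U n))"
    using separating by (elim exE)
  then have U: "U n \<in> sets X"
    and sep: "\<lbrakk>x \<in> space X; y \<in> space X; x \<noteq> y\<rbrakk> \<Longrightarrow> \<exists>n. x \<in> U n \<longleftrightarrow> y \<notin> U n" for n x y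
    by auto
  have "equiv (space X) ?E"
  proof (rule equivI)
    show "?E \<subseteq> space X \<times> space X" using act_closed by (auto simp: orbit_equiv_rel_eq)
    show "refl_on (space X) ?E"
      unfolding refl_on_def orbit_equiv_rel_eq using act_one by (force intro!: bexI[of _ \<one>])
    show "sym ?E"
    proof (rule symI)
      fix x y assume "(x, y) \<in> ?E"
      then obtain g where "x \<in> space X" "g \<in> carrier G" "y = \<phi> g x" by (auto simp: orbit_equiv_rel_eq)
      then show "(y, x) \<in> ?E" using act_closed by (auto simp: orbit_equiv_rel_eq intro!: bexI[of _ "inv g"])
    qed
    show "trans ?E"
    proof (rule transI)
      fix x y z assume "(x, y) \<in> ?E" "(y, z) \<in> ?E"
      then obtain g h where "x \<in> space X" "g \<in> carrier G" "h \<in> carrier G" "z = \<phi> h (\<phi> g x)"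
        by (auto simp: orbit_equiv_rel_eq)
      then show "(x, z) \<in> ?E" by (auto simp: orbit_equiv_rel_eq act_mult intro!: bexI[of _ "h \<otimes> g"])
    qed
  qed
  moreover have "?E \<in> sets (X \<Otimes>\<^sub>M X)"
  proof -
    have graph: "{p \<in> space (X \<Otimes>\<^sub>M X). snd p = \<phi> g (fst p)} \<in> sets (X \<Otimes>\<^sub>M X)" if g: "g \<in> carrier G" for g
    proof -
      have [measurable]: "\<phi> g \<in> X \<rightarrow>\<^sub>M X" "U n \<in> sets X" for n using act_measurable[OF g] U by auto
      have "{p \<in> space (X \<Otimes>\<^sub>M X). snd p = \<phi> g (fst p)} =
          {p \<in> space (X \<Otimes>\<^sub>M X). \<forall>n. snd p \<in> U n \<longleftrightarrow> \<phi> g (fst p) \<in> U n}"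
      proof (intro Collect_cong conj_cong refl iffI)
        fix p assume p: "p \<in> space (X \<Otimes>\<^sub>M X)" "\<forall>n. snd p \<in> U n \<longleftrightarrow> \<phi> g (fst p) \<in> U n"
        then have "snd p \<in> space X" "\<phi> g (fst p) \<in> space X"
          by (auto simp: space_pair_measure act_closed[OF g])
        then show "snd p = \<phi> g (fst p)" using sep p(2) by metis
      qed simp
      also have "\<dots> \<in> sets (X \<Otimes>\<^sub>M X)" by measurable
      finally show ?thesis .
    qed
    have "?E = (\<Union>g\<in>carrier G. {p \<in> space (X \<Otimes>\<^sub>M X). snd p = \<phi> g (fst p)})"
      using act_closed by (auto simp: orbit_equiv_rel_eq space_pair_measure)
    then show ?thesis using graph count by (auto intro: sets.countable_UN'')
  qed
  moreover have "countable (?E `` {x})" for x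
  proof (rule countable_subset)
    show "?E `` {x} \<subseteq> (\<lambda>g. \<phi> g x) ` carrier G" by (auto simp: orbit_equiv_rel_eq)
  qed (use count in simp)
  ultimately show ?thesis by (simp add: countable_borel_equiv_rel_def)
qed

end

text \<open>A countable base does this, since metrizable spaces are T1.\<close>

lemma standard_borel_separating:
  assumes "standard_borel_space X"
  shows "\<exists>U :: nat \<Rightarrow> 'x set. range U \<subseteq> sets X \<and>
    (\<forall>x\<in>space X. \<forall>y\<in>space X. x \<noteq> y \<longrightarrow> (\<exists>n. x \<in> U n \<longleftrightarrow> y \<notin> U n))"
proof -
  obtain T where T: "completely_metrizable_space T" "second_countable T" "topspace T = space X"
      "sets X = sets (borel_of T)"
    using assms by (auto simp: standard_borel_space_def polish_topology_def)
  obtain \<B> where \<B>: "countable \<B>" "\<And>V. V \<in> \<B> \<Longrightarrow> openin T V"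
      "\<And>U x. \<lbrakk>openin T U; x \<in> U\<rbrakk> \<Longrightarrow> \<exists>V\<in>\<B>. x \<in> V \<and> V \<subseteq> U"
    using T(2) unfolding second_countable_def by metis
  have t1: "t1_space T"
    using T(1) by (intro Hausdorff_imp_t1_space metrizable_imp_Hausdorff_space completely_metrizable_imp_metrizable_space)
  \<comment> \<open>Adding the empty set gives \<open>from_nat_into\<close> a nonempty set to
    enumerate even if the base is empty.\<close>
  let ?U = "from_nat_into (insert {} \<B>)"
  have range: "range ?U = insert {} \<B>" using \<B>(1) by (intro range_from_nat_into) auto
  show ?thesis
  proof (intro exI[of _ ?U] conjI ballI impI)
    show "range ?U \<subseteq> sets X"
      unfolding range T(4) sets_borel_of using \<B>(2) by (auto intro: sigma_sets.Basic sigma_sets.Empty)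
    fix x y assume xy: "x \<in> space X" "y \<in> space X" "x \<noteq> y"
    then obtain W where "openin T W" "x \<in> W" "y \<notin> W" using t1 T(3) unfolding t1_space_def by metis
    then obtain V where V: "V \<in> \<B>" "x \<in> V" "y \<notin> V" using \<B>(3) by blast
    then obtain n where "?U n = V" using range by (metis insertI2 rangeE)
    then show "\<exists>n. x \<in> ?U n \<longleftrightarrow> y \<notin> ?U n" using V by blast
  qed
qed

lemma free_borel_actionI:
  assumes "group G" "infinite (carrier G)" "standard_borel_space X" "borel_action G X \<phi>"
    "free_action G (space X) \<phi>"
  shows "free_borel_action G X \<phi>"
proof -
  interpret group_action G "space X" \<phi> using assms(4) by (simp add: borel_action_def)
  interpret group G by (rule assms(1))
  show ?thesis
  proof
    show "infinite (carrier G)" by (rule assms(2))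
    show "\<phi> g x \<in> space X" if "g \<in> carrier G" "x \<in> space X" for g x
      using element_image[OF that] by simp
    show "\<phi> g (\<phi> h x) = \<phi> (g \<otimes>\<^bsub>G\<^esub> h) x" if "g \<in> carrier G" "h \<in> carrier G" "x \<in> space X" for g h x
      using composition_rule[OF that(3,1,2)] by simp
    show "\<phi> \<one>\<^bsub>G\<^esub> x = x" if "x \<in> space X" for x
      using that fun_cong[OF id_eq_one, of x] by simp
    show "\<phi> g \<in> X \<rightarrow>\<^sub>M X" if g: "g \<in> carrier G" for g
    proof -
      have "(\<lambda>x. (g, x)) \<in> X \<rightarrow>\<^sub>M count_space (carrier G) \<Otimes>\<^sub>M X" using g by simp
      from measurable_compose[OF this, of "\<lambda>(g, x). \<phi> g x" X] show ?thesis
        using assms(4) by (simp add: borel_action_def)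
    qed
    show "g = \<one>\<^bsub>G\<^esub>" if "g \<in> carrier G" "x \<in> space X" "\<phi> g x = x" for g x
      using assms(5) that by (auto simp: free_action_def)
  qed (rule standard_borel_separating[OF assms(3)])
qed

theorem corollary2p3:
  fixes G :: "('g, 'm) monoid_scheme"
    and L :: "'i rel_language"
    and K :: "('i, nat) rel_structure set"
    and X :: "'x measure"
    and \<phi> :: "'g \<Rightarrow> 'x \<Rightarrow> 'x"
  assumes "group G" and "countable (carrier G)" and "infinite (carrier G)"
    and "countable (symbols L)"
    and "iso_closed_class L K"
    and "borel_structurable L K (free_part_borel G) (F2 G)"
    and "standard_borel_space X"
    and "borel_action G X \<phi>"
    and "free_action G (space X) \<phi>"
  shows "borel_structurable L K X (orbit_equiv_rel G (space X) \<phi>)"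
proof -
  interpret free_borel_action G X \<phi> using assms by (intro free_borel_actionI)
  let ?E = "orbit_equiv_rel G (space X) \<phi>" and ?Y = "free_part_borel G"
  obtain f where f: "f \<in> X \<rightarrow>\<^sub>M ?Y" and f_free: "\<And>x. x \<in> space X \<Longrightarrow> f x \<in> free_part G"
    and f_equiv: "\<And>g x. \<lbrakk>g \<in> carrier G; x \<in> space X\<rbrakk> \<Longrightarrow> f (\<phi> g x) = shift G g (f x)"
    using equivariant_map_to_free_part[OF assms(2)] by blast
  obtain Q where Q: "\<And>i. i \<in> symbols L \<Longrightarrow> Q i \<in> sets (PiM {..<arity L i} (\<lambda>_. ?Y))"
    and Q_class: "\<And>y. y \<in> free_part G \<Longrightarrow> in_class L K \<lparr>universe = F2 G `` {y},
        interp = (\<lambda>i. Q i \<inter> tuples (arity L i) (F2 G `` {y}))\<rparr>"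
    using assms(6) unfolding borel_structurable_def space_free_part by blast
  have E: "countable_borel_equiv_rel X ?E" by (rule countable_borel_equiv_rel_orbit[OF assms(2)])
  have E_sets [measurable]: "?E \<in> sets (X \<Otimes>\<^sub>M X)" and E_equiv: "equiv (space X) ?E"
    using E by (simp_all add: countable_borel_equiv_rel_def)
  \<comment> \<open>\<open>f\<close> may identify points of different orbits, so the preimage of
    \<open>Q i\<close> is cut down to tuples inside one class.\<close>
  define R where "R i = {t \<in> space (PiM {..<arity L i} (\<lambda>_. X)).
    compose {..<arity L i} f t \<in> Q i \<and> (\<forall>j\<in>{j. Suc j < arity L i}. (t j, t (Suc j)) \<in> ?E)}" for i
  have R_sets: "R i \<in> sets (PiM {..<arity L i} (\<lambda>_. X))" if i: "i \<in> symbols L" for i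
  proof -
    let ?n = "arity L i"
    have "(\<lambda>t. compose {..<?n} f t) \<in> PiM {..<?n} (\<lambda>_. X) \<rightarrow>\<^sub>M PiM {..<?n} (\<lambda>_. ?Y)"
      unfolding compose_def
      by (intro measurable_restrict measurable_compose[OF _ f] measurable_component_singleton)
    from measurable_sets[OF this Q[OF i]]
    have "{t \<in> space (PiM {..<?n} (\<lambda>_. X)). compose {..<?n} f t \<in> Q i} \<in> sets (PiM {..<?n} (\<lambda>_. X))"
      by (simp add: vimage_def Int_def conj_commute)
    moreover have "{t \<in> space (PiM {..<?n} (\<lambda>_. X)). \<forall>j\<in>{j. Suc j < ?n}. (t j, t (Suc j)) \<in> ?E}
        \<in> sets (PiM {..<?n} (\<lambda>_. X))"
    proof (rule sets.sets_Collect_finite_All)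
      fix j assume "j \<in> {j. Suc j < ?n}"
      then have "(\<lambda>t. (t j, t (Suc j))) \<in> PiM {..<?n} (\<lambda>_. X) \<rightarrow>\<^sub>M X \<Otimes>\<^sub>M X"
        by (intro measurable_Pair measurable_component_singleton) auto
      from measurable_sets[OF this E_sets]
      show "{t \<in> space (PiM {..<?n} (\<lambda>_. X)). (t j, t (Suc j)) \<in> ?E} \<in> sets (PiM {..<?n} (\<lambda>_. X))"
        by (simp add: vimage_def Int_def conj_commute)
    qed (rule finite_subset[of _ "{..<?n}"], auto)
    ultimately show ?thesis unfolding R_def by (intro sets.sets_Collect_conj)
  qed
  have R_class: "in_class L K \<lparr>universe = ?E `` {x}, interp = (\<lambda>i. R i \<inter> tuples (arity L i) (?E `` {x}))\<rparr>"
    (is "in_class L K ?A") if x: "x \<in> space X" for x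
  proof -
    let ?B = "\<lparr>universe = F2 G `` {f x}, interp = (\<lambda>i. Q i \<inter> tuples (arity L i) (F2 G `` {f x}))\<rparr>"
    have cls: "?E `` {x} = (\<lambda>g. \<phi> g x) ` carrier G" using x by (auto simp: orbit_equiv_rel_eq)
    have clsf: "F2 G `` {f x} = (\<lambda>g. shift G g (f x)) ` carrier G"
      using f_free[OF x] by (auto simp: F2_def orbit_equiv_rel_def orbit_def)
    \<comment> \<open>Equivariance maps the orbit onto an orbit; injectivity holds because
      stabilisers in the free part are trivial.\<close>
    have bij: "bij_betw f (?E `` {x}) (F2 G `` {f x})"
      unfolding bij_betw_def
    proof
      show "f ` (?E `` {x}) = F2 G `` {f x}"
        unfolding cls clsf image_image using f_equiv x by (intro image_cong) auto
      show "inj_on f (?E `` {x})"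
      proof (rule inj_onI)
        fix y z assume "y \<in> ?E `` {x}" "z \<in> ?E `` {x}" and eq: "f y = f z"
        then have "(y, z) \<in> ?E" using E_equiv by (meson Image_singleton_iff equivE symE transE)
        then obtain g where g: "y \<in> space X" "g \<in> carrier G" "z = \<phi> g y" by (auto simp: orbit_equiv_rel_eq)
        then have "shift G g (f y) = f y" using f_equiv eq by simp
        then have "g = \<one>\<^bsub>G\<^esub>" using f_free[OF g(1)] g(2) by (auto simp: free_part_def)
        then show "y = z" using g act_one by simp
      qed
    qed
    obtain N h where N: "N \<in> K" and h: "bij_betw h (F2 G `` {f x}) (universe N)"
      and h_iso: "\<And>i t. \<lbrakk>i \<in> symbols L; t \<in> tuples (arity L i) (F2 G `` {f x})\<rbrakk> \<Longrightarrow>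
        t \<in> Q i \<inter> tuples (arity L i) (F2 G `` {f x}) \<longleftrightarrow> compose {..<arity L i} h t \<in> interp N i"
      using Q_class[OF f_free[OF x]] unfolding in_class_def isomorphic_structures_def by auto
    \<comment> \<open>The member of \<open>K\<close> that represents the class of \<open>f x\<close>
      also represents that of \<open>x\<close>: within one class the chain condition is automatic,
      so there \<open>R i\<close> is exactly the preimage of \<open>Q i\<close>.\<close>
    have "isomorphic_structures L ?A N"
      unfolding isomorphic_structures_def
    proof (intro exI[of _ "h \<circ> f"] conjI ballI)
      show "bij_betw (h \<circ> f) (universe ?A) (universe N)" using bij_betw_trans[OF bij h] by simp
      fix i t assume i: "i \<in> symbols L" and "t \<in> tuples (arity L i) (universe ?A)"
      then have t: "t \<in> tuples (arity L i) (?E `` {x})" by simp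
      let ?n = "arity L i"
      have ft: "compose {..<?n} f t \<in> tuples ?n (F2 G `` {f x})"
        using t bij by (auto simp: compose_def PiE_iff bij_betw_def)
      have E_sub: "?E `` {x} \<subseteq> space X" using x act_closed by (auto simp: cls)
      have "t \<in> space (PiM {..<?n} (\<lambda>_. X))" using t E_sub by (auto simp: space_PiM PiE_iff)
      moreover have "(t j, t (Suc j)) \<in> ?E" if "Suc j < ?n" for j
      proof -
        have "t j \<in> ?E `` {x}" "t (Suc j) \<in> ?E `` {x}" using t that by (auto simp: PiE_iff)
        then show ?thesis using E_equiv by (meson Image_singleton_iff equivE symE transE)
      qed
      ultimately have "t \<in> R i \<longleftrightarrow> compose {..<?n} f t \<in> Q i" unfolding R_def by auto
      also have "\<dots> \<longleftrightarrow> compose {..<?n} h (compose {..<?n} f t) \<in> interp N i"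
        using h_iso[OF i ft] ft by simp
      also have "compose {..<?n} h (compose {..<?n} f t) = compose {..<?n} (h \<circ> f) t"
        by (auto simp: compose_def fun_eq_iff)
      finally show "t \<in> interp ?A i \<longleftrightarrow> compose {..<?n} (h \<circ> f) t \<in> interp N i" using t by simp
    qed
    then show ?thesis using N unfolding in_class_def is_structure_def by auto
  qed
  have "R i \<subseteq> {t \<in> tuples (arity L i) (space X). \<forall>j. Suc j < arity L i \<longrightarrow> (t j, t (Suc j)) \<in> ?E}" for i
    by (auto simp: R_def space_PiM)
  with R_sets R_class E assms(7) show ?thesis
    unfolding borel_structurable_def by (intro conjI exI[of _ R]) auto
qed

end
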